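(* For each $d\geq 1$, the collection of $\mathbb{Z}$-modules $\mathcal{L}_d^{*}$ and linear maps $\delta_d^{i}:\mathcal{L}_d^{i-1}\to\mathcal{L}_d^{i}$, defined on each leaf diagram $L$ by $$\delta_d^i(L)=\sum_{e \text{ admissible edge of } L}\varepsilon_L(e)\cdot L_e ,$$ forms a cochain complex of $\mathbb{Z}$-modules, i.e. $\delta_d^{i+1}\circ\delta_d^{i}=0$ for all $i$.
   Context: **Polygons.** A polygon is a finite subset of the oriented based circle $\mathbb{S}^1=\mathbb{R}\cup\{\infty\}$, identified with the corresponding singular $0$-chain in $C_0(\mathbb{S}^1,\mathbb{Z}_2)$; sums of polygons are sums of such chains (symmetric differences). A polygon is even or odd according to its cardinality. By convention $\infty$ is greater than any real number. Signs are written multiplicatively, $\mathbb{Z}_2=\{\pm1\}$. For disjoint even polygons $P,P'$, $\operatorname{lk}(P,P')\in\{\pm1\}$ is the algebraic intersection number mod 2 of $P'$ with any $1$-chain in $C_1(\mathbb{S}^1,\mathbb{Z}_2)$ with boundary $P$ (so it is symmetric and bilinear: $\operatorname{lk}(P,P'+P'')=\operatorname{lk}(P,P')\operatorname{lk}(P,P'')$). If $P$ has two elements and $P'$ is any polygon disjoint from $P$ (possibly odd), $\operatorname{lk}(P,P')=\operatorname{lk}(P',P)=(-1)^{\sharp([\min P,\max P]\cap P')}$; $\operatorname{lk}$ is extended by symmetry and bilinearity to all couples of disjoint polygons at least one of which is even. Partial order: $P<P'$ iff $\inf P<\inf P'$. **Leaf diagrams.** A (coloured) leaf diagram is a finite collection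 of pairwise disjoint (nonempty) polygons, none containing $\infty$. Elements of the polygons are leaves; leaves in the same polygon have the same colour. The Gauss degree is $\deg(L)=\#\text{leaves}-\#\text{polygons}$, the codimension (cohomological degree) is $\iota(L)=\#\text{leaves}-2\,\#\text{polygons}$. Leaf diagrams are regarded up to orientation-preserving homeomorphisms of $\mathbb{R}=\mathbb{S}^1\setminus\{\infty\}$. $\mathcal{L}_d^i$ is the free $\mathbb{Z}$-module on equivalence classes of leaf diagrams with Gauss degree $d$ and codimension $i$. Polygons with a single leaf are allowed. **Edges.** An edge of $L$ is a closed connected part of the circle lying between two neighbouring leaves, containing no leaf in its interior and not containing $\infty$. It is admissible if its two boundary points have different colours. For an admissible edge $e$ with boundary leaves $v\in P_v$, $w\in P_w$, $L_e$ is the leaf diagram obtained from $L$ by merging $P_v$ and $P_w$ into a single polygon $P_{vw}$ and removing one of the two points $v,w$ from it (which one does not matter up to positive homeomorphism). Then $\deg(L_e)=\deg(L)$ and $\iota(L_e)=\iota(L)+1$. **Signs.** A boolean expression has value $-1$ when true and $+1$ otherwise. For an odd polygon $P$ in $L$, $\mathrm{Odd}(P,L)=\prod_{P'\text{ odd polygon of }L}(P<P')$; for even $P$, $\mathrm{Odd}(P,L)=1$. The global sign is $$\sigma_{\mathrm{glo}}(e,L)=\mathrm{Odd}(P_v,L)\,\mathrm{Odd}(P_w,L)\,\mathrm{Odd}(P_{vw},L_e).$$ For a leaf $x$ in polygon $P_x$, set $P_x^{(x)}=P_x+x=P_x\setminus\{x\}$ if $P_x$ is odd and $P_x^{(x)}=P_x$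 if $P_x$ is even. For an admissible edge $e$ bounded by $v,w$: - $\operatorname{lk}(e)=\operatorname{lk}(P_v^{(v)},P_w^{(w)})$; - $\operatorname{E}(P_v,e)=\operatorname{lk}(v+\infty,P_w)$ if $P_v$ is even, and $1$ otherwise (and symmetrically $\operatorname{E}(P_w,e)=\operatorname{lk}(w+\infty,P_v)$ if $P_w$ is even, $1$ otherwise), where $v+\infty$ is the polygon $\{v,\infty\}$; - $\psi(e)=(v<w)(P_v<P_w)$ if $P_v$ and $P_w$ are both odd, and $1$ otherwise. The local sign is $\sigma_{\mathrm{loc}}(e,L)=\operatorname{lk}(e)\,\psi(e)\,\operatorname{E}(P_v,e)\,\operatorname{E}(P_w,e)$, and $\varepsilon_L(e)=\sigma_{\mathrm{loc}}(e,L)\,\sigma_{\mathrm{glo}}(e,L)$. *)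

theory Defs
  imports "HOL-Analysis.Analysis" "HOL-Algebra.Free_Abelian_Groups"
begin

section \<open>The based oriented circle and the linking sign of polygons\<close>

datatype circle = Pt real | Infty

instantiation circle :: linorder
begin

fun less_eq_circle :: "circle \<Rightarrow> circle \<Rightarrow> bool" where
  "less_eq_circle (Pt x) (Pt y) = (x \<le> y)"
| "less_eq_circle (Pt x) Infty = True"
| "less_eq_circle Infty (Pt y) = False"
| "less_eq_circle Infty Infty = True"

definition less_circle :: "circle \<Rightarrow> circle \<Rightarrow> bool" where
  "less_circle x y \<longleftrightarrow> x \<le> y \<and> \<not> y \<le> x"

instance
proof
  fix x y z :: circle
  show "x < y \<longleftrightarrow> x \<le> y \<and> \<not> y \<le> x" by (rule less_circle_def)
  show "x \<le> x" by (cases x) auto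
  show "x \<le> y \<Longrightarrow> y \<le> z \<Longrightarrow> x \<le> z" by (cases x; cases y; cases z) auto
  show "x \<le> y \<Longrightarrow> y \<le> x \<Longrightarrow> x = y" by (cases x; cases y) auto
  show "x \<le> y \<or> y \<le> x" by (cases x; cases y) auto
qed

end

text \<open>A polygon is a finite set of points of the circle, seen as a singular 0-chain mod 2; the sum
of polygons is the symmetric difference \<^const>\<open>sym_diff\<close>.\<close>

definition polygon :: "circle set \<Rightarrow> bool" where
  "polygon P \<longleftrightarrow> finite P"

text \<open>Signs live in the multiplicative group \<open>{1, -1}\<close> of the integers; true is \<open>-1\<close>.\<close>

definition bsign :: "bool \<Rightarrow> int" where
  "bsign b = (if b then - 1 else 1)"

text \<open>For an even polygon \<open>P = {p1 < p2 < ... < p2k}\<close> this is the support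
\<open>[p1,p2) \<union> [p3,p4) \<union> ... \<union> [p2k-1,p2k)\<close> of a 1-chain mod 2 with boundary \<open>P\<close>. Which of the
endpoints are included plays no role when counting points of a polygon disjoint from \<open>P\<close>.\<close>

definition filling :: "circle set \<Rightarrow> circle set" where
  "filling P = {x. odd (card {p \<in> P. p \<le> x})}"

text \<open>The linking sign, meaningful for disjoint polygons at least one of which is even. The
lemmas below establish the properties that characterise it: symmetry (\<open>lk_commute\<close>),
bilinearity (\<open>lk_sum_left\<close>, \<open>lk_sum_right\<close>), the formula for a two-element polygon
(\<open>lk_two\<close>), and independence of the 1-chain (\<open>lk_any_chain\<close>).\<close>

definition lk :: "circle set \<Rightarrow> circle set \<Rightarrow> int" where
  "lk P Q = (if even (card P) then (- 1) ^ card (filling P \<inter> Q)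
             else (- 1) ^ card (filling Q \<inter> P))"

lemma prod_bsign: "finite A \<Longrightarrow> (\<Prod>x\<in>A. bsign (R x)) = (- 1) ^ card {x \<in> A. R x}"
  by (simp add: bsign_def prod.If_cases Int_def)

lemma filling_sign:
  assumes "finite P" "finite Q"
  shows "(- 1) ^ card (filling P \<inter> Q) = (\<Prod>q\<in>Q. \<Prod>p\<in>P. bsign (p \<le> q))"
proof -
  have "(\<Prod>q\<in>Q. \<Prod>p\<in>P. bsign (p \<le> q)) = (\<Prod>q\<in>Q. bsign (q \<in> filling P))"
    using assms by (intro prod.cong) (simp_all add: prod_bsign filling_def bsign_def[of "_ \<in> _"] bsign_def[of "odd _"])
  also have "\<dots> = (- 1) ^ card (filling P \<inter> Q)"
    using assms by (simp add: prod_bsign Int_def conj_commute)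
  finally show ?thesis by simp
qed

lemma filling_sign_commute:
  assumes "finite P" "finite Q" "P \<inter> Q = {}" "even (card P)"
  shows "(- 1 :: int) ^ card (filling P \<inter> Q) = (- 1) ^ card (filling Q \<inter> P)"
proof -
  have "(- 1 :: int) ^ card (filling Q \<inter> P) = (\<Prod>p\<in>P. \<Prod>q\<in>Q. bsign (q \<le> p))"
    using assms by (simp add: filling_sign)
  also have "\<dots> = (\<Prod>q\<in>Q. \<Prod>p\<in>P. bsign (q \<le> p))"
    by (rule prod.swap)
  also have "\<dots> = (\<Prod>q\<in>Q. \<Prod>p\<in>P. (- 1) * bsign (p \<le> q))"
  proof (intro prod.cong refl)
    fix p q assume "q \<in> Q" "p \<in> P"
    then have "p \<noteq> q" using assms by auto
    then show "bsign (q \<le> p) = (- 1) * bsign (p \<le> q)" by (auto simp: bsign_def)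
  qed
  also have "\<dots> = (\<Prod>q\<in>Q. \<Prod>p\<in>P. bsign (p \<le> q))"
    using assms by (simp only: prod.distrib prod_constant) simp
  finally show ?thesis using assms by (simp add: filling_sign)
qed

lemma lk_commute:
  assumes "polygon P" "polygon Q" "P \<inter> Q = {}" "even (card P) \<or> even (card Q)"
  shows "lk P Q = lk Q P"
  using assms filling_sign_commute[of P Q] by (auto simp: lk_def polygon_def)

lemma prod_sym_diff:
  fixes f :: "'a \<Rightarrow> int"
  assumes "finite A" "finite B" "\<And>x. f x * f x = 1"
  shows "prod f (sym_diff A B) = prod f A * prod f B"
proof -
  have 1: "prod f A = prod f (A - B) * prod f (A \<inter> B)"
    using prod.Int_Diff[of A f B] assms by (simp add: mult.commute)
  have 2: "prod f B = prod f (B - A) * prod f (A \<inter> B)"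
    using prod.Int_Diff[of B f A] assms by (simp add: mult.commute Int_commute)
  have 3: "prod f (A \<inter> B) * prod f (A \<inter> B) = 1"
    by (simp add: assms(3) flip: prod.distrib)
  have "prod f (sym_diff A B) = prod f (A - B) * prod f (B - A)"
    using assms by (intro prod.union_disjoint) auto
  also have "\<dots> = prod f (A - B) * prod f (B - A) * (prod f (A \<inter> B) * prod f (A \<inter> B))"
    by (simp add: 3)
  finally show ?thesis by (simp add: 1 2 mult_ac)
qed

lemma even_card_sym_diff:
  assumes "finite A" "finite B"
  shows "even (card (sym_diff A B)) \<longleftrightarrow> (even (card A) \<longleftrightarrow> even (card B))"
proof -
  have "(\<Prod>x\<in>sym_diff A B. - 1 :: int) = (\<Prod>x\<in>A. - 1) * (\<Prod>x\<in>B. - 1)"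
    by (rule prod_sym_diff) (use assms in auto)
  then have "(- 1 :: int) ^ card (sym_diff A B) = (- 1) ^ (card A + card B)"
    by (simp only: prod_constant power_add)
  then have "even (card (sym_diff A B)) \<longleftrightarrow> even (card A + card B)"
    by (simp only: minus_one_power_iff split: if_splits)
  then show ?thesis by simp
qed

lemma lk_alt:
  assumes "polygon P" "polygon Q" "P \<inter> Q = {}" "even (card P) \<or> even (card Q)"
  shows "lk P Q = (if even (card P) then (\<Prod>q\<in>Q. \<Prod>p\<in>P. bsign (p \<le> q))
                   else (\<Prod>q\<in>Q. \<Prod>p\<in>P. bsign (q \<le> p)))"
proof (cases "even (card P)")
  case True
  then show ?thesis using assms by (simp add: lk_def polygon_def filling_sign)
next
  case False
  have "(\<Prod>q\<in>Q. \<Prod>p\<in>P. bsign (q \<le> p)) = (\<Prod>p\<in>P. \<Prod>q\<in>Q. bsign (q \<le> p))"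
    by (rule prod.swap)
  then show ?thesis using assms False by (simp add: lk_def polygon_def filling_sign)
qed

lemma bsign_square [simp]: "bsign b * bsign b = 1"
  by (simp add: bsign_def)

lemma prod_bsign_square: "(\<Prod>x\<in>A. bsign (R x)) * (\<Prod>x\<in>A. bsign (R x)) = 1"
  by (simp flip: prod.distrib)

lemma lk_sum_right:
  assumes "polygon P" "polygon Q" "polygon Q'" "P \<inter> Q = {}" "P \<inter> Q' = {}"
    and "even (card P) \<or> even (card Q) \<and> even (card Q')"
  shows "lk P (sym_diff Q Q') = lk P Q * lk P Q'"
proof -
  have "polygon (sym_diff Q Q')" "P \<inter> sym_diff Q Q' = {}"
    "even (card P) \<or> even (card (sym_diff Q Q'))"
    using assms even_card_sym_diff[of Q Q'] by (auto simp: polygon_def)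
  moreover have "(\<Prod>q\<in>sym_diff Q Q'. \<Prod>p\<in>P. bsign (R p q)) =
      (\<Prod>q\<in>Q. \<Prod>p\<in>P. bsign (R p q)) * (\<Prod>q\<in>Q'. \<Prod>p\<in>P. bsign (R p q))" for R
    using assms by (intro prod_sym_diff prod_bsign_square) (auto simp: polygon_def)
  ultimately show ?thesis
    using assms by (auto simp: lk_alt simp del: Un_iff)
qed

lemma lk_sum_left:
  assumes "polygon P" "polygon P'" "polygon Q" "P \<inter> Q = {}" "P' \<inter> Q = {}"
    and "even (card Q) \<or> even (card P) \<and> even (card P')"
  shows "lk (sym_diff P P') Q = lk P Q * lk P' Q"
proof -
  have "polygon (sym_diff P P')" "sym_diff P P' \<inter> Q = {}"
    using assms by (auto simp: polygon_def)
  then show ?thesis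
    using assms lk_sum_right[of Q P P'] lk_commute[of P Q] lk_commute[of P' Q]
      lk_commute[of "sym_diff P P'" Q] even_card_sym_diff[of P P']
    by (auto simp: Int_commute polygon_def)
qed

lemma lk_two:
  assumes "card P = 2" "polygon Q" "P \<inter> Q = {}"
  shows "lk P Q = (- 1) ^ card ({Min P..Max P} \<inter> Q)"
proof -
  obtain a b where P: "P = {a, b}" "a < b"
    using assms(1) by (metis card_2_iff insert_commute linorder_neq_iff)
  have "filling P \<inter> Q = {Min P..Max P} \<inter> Q"
  proof -
    have "x \<in> filling P \<longleftrightarrow> x \<in> {Min P..Max P}" if "x \<in> Q" for x
    proof -
      have ne: "x \<noteq> a" "x \<noteq> b" using that assms P by auto
      consider "x < a" | "a < x" "x < b" | "b < x" using ne by fastforce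
      then have "odd (card {p \<in> P. p \<le> x}) \<longleftrightarrow> a < x \<and> x < b"
      proof cases
        case 1
        then have e: "{p \<in> P. p \<le> x} = {}" using P by auto
        show ?thesis unfolding e using 1 P(2) by auto
      next
        case 2
        then have e: "{p \<in> P. p \<le> x} = {a}" using P by auto
        show ?thesis unfolding e using 2 P(2) by auto
      next
        case 3
        then have e: "{p \<in> P. p \<le> x} = {a, b}" using P by auto
        show ?thesis unfolding e using 3 P(2) by auto
      qed
      then have "x \<in> filling P \<longleftrightarrow> a < x \<and> x < b"
        by (simp only: filling_def mem_Collect_eq)
      also have "\<dots> \<longleftrightarrow> a \<le> x \<and> x \<le> b" using ne by (metis less_le)
      also have "\<dots> \<longleftrightarrow> x \<in> {Min P..Max P}"
      proof -
        have "Min P = a" "Max P = b" using P(2) unfolding P(1) by auto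
        then show ?thesis by simp
      qed
      finally show ?thesis .
    qed
    then show ?thesis by blast
  qed
  then show ?thesis using assms by (simp add: lk_def)
qed

text \<open>A 1-chain given as a sum of segments, each encoded by its pair of endpoints.\<close>

lemma lk_any_chain:
  assumes "polygon Q" "\<And>s. s \<in> set c \<Longrightarrow> card s = 2 \<and> s \<inter> Q = {}"
  shows "lk (foldr (\<lambda>s t. sym_diff s t) c {}) Q =
         (\<Prod>s\<leftarrow>c. (- 1) ^ card ({Min s..Max s} \<inter> Q))"
proof -
  define bd where "bd = (\<lambda>c. foldr (\<lambda>s t :: circle set. sym_diff s t) c {})"
  have "polygon (bd c) \<and> bd c \<inter> Q = {} \<and> even (card (bd c)) \<and>
      lk (bd c) Q = (\<Prod>s\<leftarrow>c. (- 1) ^ card ({Min s..Max s} \<inter> Q))"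
    using assms(2)
  proof (induction c)
    case Nil
    then show ?case by (simp add: bd_def polygon_def lk_def filling_def)
  next
    case (Cons s c)
    have IH: "polygon (bd c)" "bd c \<inter> Q = {}" "even (card (bd c))"
      "lk (bd c) Q = (\<Prod>s\<leftarrow>c. (- 1) ^ card ({Min s..Max s} \<inter> Q))"
      using Cons by auto
    have s: "card s = 2" "s \<inter> Q = {}" using Cons.prems[of s] by auto
    then have fin: "polygon s" by (auto simp: polygon_def intro: card_ge_0_finite)
    have bd: "bd (s # c) = sym_diff s (bd c)" by (simp add: bd_def)
    have "lk (bd (s # c)) Q = lk s Q * lk (bd c) Q"
      unfolding bd by (rule lk_sum_left) (use IH s fin assms in auto)
    moreover have "even (card (bd (s # c)))"
      unfolding bd using even_card_sym_diff[of s "bd c"] IH s fin by (simp add: polygon_def)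
    moreover have "polygon (bd (s # c))" "bd (s # c) \<inter> Q = {}"
      unfolding bd using IH s fin by (auto simp: polygon_def)
    ultimately show ?case using IH s assms by (simp add: lk_two)
  qed
  then show ?thesis by (simp add: bd_def)
qed

section \<open>Leaf diagrams\<close>

definition leaf_diagram :: "circle set set \<Rightarrow> bool" where
  "leaf_diagram L \<longleftrightarrow> finite L \<and> (\<forall>P\<in>L. polygon P \<and> P \<noteq> {} \<and> Infty \<notin> P) \<and> disjoint L"

abbreviation leaves :: "circle set set \<Rightarrow> circle set" where
  "leaves L \<equiv> \<Union>L"

definition gauss_degree :: "circle set set \<Rightarrow> int" where
  "gauss_degree L = int (card (leaves L)) - int (card L)"

definition codimension :: "circle set set \<Rightarrow> int" where
  "codimension L = int (card (leaves L)) - 2 * int (card L)"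

primrec circle_extension :: "(real \<Rightarrow> real) \<Rightarrow> circle \<Rightarrow> circle" where
  "circle_extension h (Pt x) = Pt (h x)"
| "circle_extension h Infty = Infty"

definition leaf_equiv :: "(circle set set \<times> circle set set) set" where
  "leaf_equiv = {(L, L'). leaf_diagram L \<and> leaf_diagram L' \<and>
     (\<exists>h g. homeomorphism UNIV UNIV h g \<and> strict_mono h \<and>
            L' = (\<lambda>P. circle_extension h ` P) ` L)}"

abbreviation leaf_class :: "circle set set \<Rightarrow> circle set set set" where
  "leaf_class L \<equiv> leaf_equiv `` {L}"

definition leaf_module :: "nat \<Rightarrow> int \<Rightarrow> (circle set set set \<Rightarrow>\<^sub>0 int) monoid" where
  "leaf_module d i = free_Abelian_group
     ({L. leaf_diagram L \<and> gauss_degree L = int d \<and> codimension L = i} // leaf_equiv)"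

section \<open>Edges and contractions\<close>

text \<open>The edge \<open>[v,w]\<close> is encoded by its pair of boundary leaves with \<open>v < w\<close>. As \<^const>\<open>Infty\<close>
is the greatest point and not a leaf, it does not lie on \<open>[v,w]\<close>.\<close>

definition edges :: "circle set set \<Rightarrow> (circle \<times> circle) set" where
  "edges L = {(v, w). v \<in> leaves L \<and> w \<in> leaves L \<and> v < w \<and> {v<..<w} \<inter> leaves L = {}}"

definition polygon_of :: "circle set set \<Rightarrow> circle \<Rightarrow> circle set" where
  "polygon_of L x = (THE P. P \<in> L \<and> x \<in> P)"

text \<open>Each polygon has its own colour, so having different colours means lying in different
polygons.\<close>

definition admissible_edges :: "circle set set \<Rightarrow> (circle \<times> circle) set" where
  "admissible_edges L = {(v, w) \<in> edges L. polygon_of L v \<noteq> polygon_of L w}"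

text \<open>Of the two boundary leaves of the contracted edge, the greater one \<open>w\<close> is removed.\<close>

definition merged_polygon :: "circle set set \<Rightarrow> circle \<times> circle \<Rightarrow> circle set" where
  "merged_polygon L = (\<lambda>(v, w). (polygon_of L v \<union> polygon_of L w) - {w})"

definition contract :: "circle set set \<Rightarrow> circle \<times> circle \<Rightarrow> circle set set" where
  "contract L = (\<lambda>(v, w).
     insert (merged_polygon L (v, w)) (L - {polygon_of L v, polygon_of L w}))"

section \<open>Signs\<close>

definition polygon_less :: "circle set \<Rightarrow> circle set \<Rightarrow> bool" where
  "polygon_less P Q \<longleftrightarrow> Min P < Min Q"

definition Odd_sign :: "circle set \<Rightarrow> circle set set \<Rightarrow> int" where
  "Odd_sign P L = (if odd (card P) then \<Prod>Q\<in>{Q \<in> L. odd (card Q)}. bsign (polygon_less P Q) else 1)"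

definition global_sign :: "circle set set \<Rightarrow> circle \<times> circle \<Rightarrow> int" where
  "global_sign L = (\<lambda>(v, w).
     Odd_sign (polygon_of L v) L * Odd_sign (polygon_of L w) L *
     Odd_sign (merged_polygon L (v, w)) (contract L (v, w)))"

definition even_part :: "circle \<Rightarrow> circle set \<Rightarrow> circle set" where
  "even_part x P = (if odd (card P) then P - {x} else P)"

definition lk_edge :: "circle set set \<Rightarrow> circle \<times> circle \<Rightarrow> int" where
  "lk_edge L = (\<lambda>(v, w). lk (even_part v (polygon_of L v)) (even_part w (polygon_of L w)))"

text \<open>\<open>E_sign v P Q\<close> is \<open>E(P, e)\<close>, where \<open>v \<in> P\<close> is an end of the edge \<open>e\<close> and \<open>Q\<close> is the polygon
of its other end.\<close>

definition E_sign :: "circle \<Rightarrow> circle set \<Rightarrow> circle set \<Rightarrow> int" where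
  "E_sign v P Q = (if even (card P) then lk {v, Infty} Q else 1)"

definition psi_sign :: "circle set set \<Rightarrow> circle \<times> circle \<Rightarrow> int" where
  "psi_sign L = (\<lambda>(v, w).
     if odd (card (polygon_of L v)) \<and> odd (card (polygon_of L w))
     then bsign (v < w) * bsign (polygon_less (polygon_of L v) (polygon_of L w)) else 1)"

definition local_sign :: "circle set set \<Rightarrow> circle \<times> circle \<Rightarrow> int" where
  "local_sign L = (\<lambda>(v, w).
     lk_edge L (v, w) * psi_sign L (v, w) *
     E_sign v (polygon_of L v) (polygon_of L w) * E_sign w (polygon_of L w) (polygon_of L v))"

definition edge_sign :: "circle set set \<Rightarrow> circle \<times> circle \<Rightarrow> int" where
  "edge_sign L e = local_sign L e * global_sign L e"

section \<open>The coboundary\<close>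

definition diagram_coboundary :: "circle set set \<Rightarrow> (circle set set set \<Rightarrow>\<^sub>0 int)" where
  "diagram_coboundary L =
     (\<Sum>e\<in>admissible_edges L. frag_cmul (edge_sign L e) (frag_of (leaf_class (contract L e))))"

text \<open>The linear extension of the formula above, evaluated on a class through a representative.
That the value does not depend on the representative has to be proved; it is not part of the
definition.\<close>

definition leaf_coboundary ::
    "nat \<Rightarrow> int \<Rightarrow> (circle set set set \<Rightarrow>\<^sub>0 int) \<Rightarrow> (circle set set set \<Rightarrow>\<^sub>0 int)" where
  "leaf_coboundary d i = restrict (frag_extend (\<lambda>X. diagram_coboundary (SOME L. L \<in> X)))
     (carrier (leaf_module d (i - 1)))"

text \<open>Cochain complexes of \<open>\<int>\<close>-modules, that is of abelian groups; the differential \<open>\<delta> i\<close> goes from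
degree \<open>i - 1\<close> to degree \<open>i\<close>.\<close>

definition cochain_complex :: "(int \<Rightarrow> ('a, 'b) monoid_scheme) \<Rightarrow> (int \<Rightarrow> 'a \<Rightarrow> 'a) \<Rightarrow> bool" where
  "cochain_complex C \<delta> \<longleftrightarrow>
     (\<forall>i. comm_group (C i)) \<and>
     (\<forall>i. \<delta> i \<in> hom (C (i - 1)) (C i)) \<and>
     (\<forall>i. \<forall>x\<in>carrier (C (i - 1)). \<delta> (i + 1) (\<delta> i x) = \<one>\<^bsub>C (i + 1)\<^esub>)"

lemma finite_leaves: "leaf_diagram L \<Longrightarrow> finite (leaves L)"
  by (auto simp: leaf_diagram_def polygon_def)

lemma finite_admissible_edges: "leaf_diagram L \<Longrightarrow> finite (admissible_edges L)"
  by (rule finite_subset[of _ "leaves L \<times> leaves L"])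
    (auto simp: admissible_edges_def edges_def dest: finite_leaves)

lemma polygon_of_eq: "leaf_diagram L \<Longrightarrow> P \<in> L \<Longrightarrow> x \<in> P \<Longrightarrow> polygon_of L x = P"
  unfolding polygon_of_def leaf_diagram_def disjoint_def by (rule the_equality) blast+

lemma leaf_equivI:
  assumes "leaf_diagram L" "leaf_diagram L'" "homeomorphism UNIV UNIV h g" "strict_mono h"
    and "L' = (\<lambda>P. circle_extension h ` P) ` L"
  shows "(L, L') \<in> leaf_equiv"
  unfolding leaf_equiv_def using assms by blast

lemma leaf_equivE:
  assumes "(L, L') \<in> leaf_equiv"
  obtains h g where "leaf_diagram L" "leaf_diagram L'" "homeomorphism UNIV UNIV h g"
    "strict_mono h" "L' = (\<lambda>P. circle_extension h ` P) ` L"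
  using assms unfolding leaf_equiv_def by blast

lemma equiv_leaf_equiv: "equiv (Collect leaf_diagram) leaf_equiv"
proof (rule equivI)
  show "leaf_equiv \<subseteq> Collect leaf_diagram \<times> Collect leaf_diagram"
    by (auto elim: leaf_equivE)
  show "refl_on (Collect leaf_diagram) leaf_equiv"
  proof (rule refl_onI)
    fix L assume "L \<in> Collect leaf_diagram"
    then have L: "leaf_diagram L" by simp
    have "circle_extension (\<lambda>x. x) x = x" for x by (cases x) simp_all
    then have eq: "L = (\<lambda>P. circle_extension (\<lambda>x. x) ` P) ` L" by simp
    show "(L, L) \<in> leaf_equiv"
      by (rule leaf_equivI[OF L L _ _ eq, of "\<lambda>x. x"])
        (simp_all add: homeomorphism_ident strict_mono_def)
  qed
  show "sym leaf_equiv"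
  proof (rule symI)
    fix L L' assume "(L, L') \<in> leaf_equiv"
    then obtain h g where a: "leaf_diagram L" "leaf_diagram L'" "homeomorphism UNIV UNIV h g"
      "strict_mono h" "L' = (\<lambda>P. circle_extension h ` P) ` L"
      by (rule leaf_equivE)
    have gh: "g (h x) = x" "h (g x) = x" for x
      using a(3) by (auto simp: homeomorphism_def)
    have "circle_extension g (circle_extension h x) = x" for x
      by (cases x) (simp_all add: gh)
    then have "L = (\<lambda>P. circle_extension g ` P) ` L'"
      unfolding a(5) by (simp add: image_image)
    moreover have "strict_mono g"
    proof (rule strict_monoI)
      fix x y :: real assume "x < y"
      then show "g x < g y" using strict_mono_less[OF a(4), of "g x" "g y"] by (simp add: gh)
    qed
    ultimately show "(L', L) \<in> leaf_equiv"
      by (intro leaf_equivI[OF a(2,1) homeomorphism_symD[OF a(3)]])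
  qed
  show "trans leaf_equiv"
  proof (rule transI)
    fix L L' L'' assume "(L, L') \<in> leaf_equiv" "(L', L'') \<in> leaf_equiv"
    then obtain h g h' g' where a: "leaf_diagram L" "leaf_diagram L''"
      "homeomorphism UNIV UNIV h g" "strict_mono h" "L' = (\<lambda>P. circle_extension h ` P) ` L"
      "homeomorphism UNIV UNIV h' g'" "strict_mono h'" "L'' = (\<lambda>P. circle_extension h' ` P) ` L'"
      by (elim leaf_equivE) metis
    have "circle_extension h' (circle_extension h x) = circle_extension (h' \<circ> h) x" for x
      by (cases x) simp_all
    then have "L'' = (\<lambda>P. circle_extension (h' \<circ> h) ` P) ` L"
      unfolding a(8) a(5) by (simp add: image_image)
    moreover have "strict_mono (h' \<circ> h)"
      using a(4,7) by (simp add: strict_mono_def)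
    ultimately show "(L, L'') \<in> leaf_equiv"
      by (intro leaf_equivI[OF a(1,2) homeomorphism_compose[OF a(3,6)]])
  qed
qed

end

theory Submission
  imports Defs
begin

text \<open>Up to a change of basis by signs, the differential of this complex alternates along the line.
Order the polygons of \<open>L\<close> by their minima and list the leaves of each polygon in increasing order;
the shuffle sign \<open>s(L)\<close> is the signature of the permutation that puts this list into the order of
the line. For an admissible edge \<open>e = (v, w)\<close> all the linking numbers and parity corrections
combine to \<open>\<epsilon>(e) = s(L) s(L\<^sub>e) (-1)\<^sup>N\<close>, where \<open>N\<close> is the number of leaves \<open>\<ge> w\<close>.
Contracting two edges in either order gives the same diagram. Removing the greater of the two upper
ends lowers the number \<open>N\<close> of the other edge by one, but not conversely, so the two orders come
with opposite signs. The same formula shows that the signs are invariant under homeomorphisms.\<close>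

section \<open>The shuffle sign\<close>

lemma leaf_diagramD:
  assumes "leaf_diagram L"
  shows "finite L" "P \<in> L \<Longrightarrow> finite P" "P \<in> L \<Longrightarrow> P \<noteq> {}" "P \<in> L \<Longrightarrow> Infty \<notin> P"
    "P \<in> L \<Longrightarrow> Q \<in> L \<Longrightarrow> P \<noteq> Q \<Longrightarrow> P \<inter> Q = {}"
  using assms by (auto simp: leaf_diagram_def polygon_def disjoint_def)

text \<open>The parity of the inversions between two blocks when \<open>A\<close> is listed before
  \<open>B\<close>.\<close>

definition crossing_sign :: "circle set \<Rightarrow> circle set \<Rightarrow> int" where
  "crossing_sign A B = (\<Prod>a\<in>A. \<Prod>b\<in>B. bsign (b < a))"

text \<open>Each polygon is listed in increasing order, so inversions only arise between different
  polygons. The condition \<open>polygon_less A B\<close> selects each unordered pair once, in the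
  order of the minima.\<close>

definition shuffle_sign :: "circle set set \<Rightarrow> int" where
  "shuffle_sign L = (\<Prod>A\<in>L. \<Prod>B\<in>L. if polygon_less A B then crossing_sign A B else 1)"

text \<open>The contribution of an unordered pair to \<open>shuffle_sign\<close>, computed from
  either order of its members. The second factor is the Koszul sign for exchanging two odd blocks
  that stand in the wrong order.\<close>

definition pair_sign :: "circle set \<Rightarrow> circle set \<Rightarrow> int" where
  "pair_sign A B = crossing_sign A B * bsign (odd (card A) \<and> odd (card B) \<and> polygon_less B A)"

section \<open>Crossing signs under splitting, deletion and exchange of blocks\<close>

lemma crossing_sign_square: "crossing_sign A B * crossing_sign A B = 1"
  unfolding crossing_sign_def by (simp flip: prod.distrib)

lemma shuffle_sign_square: "shuffle_sign L * shuffle_sign L = 1"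
proof -
  have "(if b then crossing_sign A B else 1) * (if b then crossing_sign A B else 1) = 1" for A B b
    by (simp add: crossing_sign_square)
  then show ?thesis
    unfolding shuffle_sign_def by (simp flip: prod.distrib)
qed

lemma crossing_sign_insert_right:
  "finite B \<Longrightarrow> b \<notin> B \<Longrightarrow> crossing_sign A (insert b B) = crossing_sign A {b} * crossing_sign A B"
  by (simp add: crossing_sign_def prod.distrib)

lemma crossing_sign_insert_left:
  "finite A \<Longrightarrow> a \<notin> A \<Longrightarrow> crossing_sign (insert a A) B = crossing_sign {a} B * crossing_sign A B"
  by (simp add: crossing_sign_def)

lemma crossing_sign_remove_right:
  assumes "finite B" "b \<in> B"
  shows "crossing_sign A (B - {b}) = crossing_sign A B * crossing_sign A {b}"
proof -
  have "crossing_sign A B = crossing_sign A {b} * crossing_sign A (B - {b})"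
    using crossing_sign_insert_right[of "B - {b}" b A] assms by (simp add: insert_absorb)
  then show ?thesis
    using crossing_sign_square[of A "{b}"] by (simp add: mult_ac)
qed

lemma crossing_sign_remove_left:
  assumes "finite A" "a \<in> A"
  shows "crossing_sign (A - {a}) B = crossing_sign A B * crossing_sign {a} B"
proof -
  have "crossing_sign A B = crossing_sign {a} B * crossing_sign (A - {a}) B"
    using crossing_sign_insert_left[of "A - {a}" a B] assms by (simp add: insert_absorb)
  then show ?thesis
    using crossing_sign_square[of "{a}" B] by (simp add: mult_ac)
qed

lemma crossing_sign_Un_right:
  "finite B \<Longrightarrow> finite C \<Longrightarrow> B \<inter> C = {} \<Longrightarrow>
    crossing_sign A (B \<union> C) = crossing_sign A B * crossing_sign A C"
  by (simp add: crossing_sign_def prod.union_disjoint prod.distrib)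

text \<open>Disjointness rules out ties, so every one of the \<open>card A * card B\<close> pairs is
  an inversion in exactly one of the two orders.\<close>

lemma crossing_sign_commute:
  assumes "A \<inter> B = {}"
  shows "crossing_sign B A = (- 1) ^ (card A * card B) * crossing_sign A B"
proof -
  have "crossing_sign B A = (\<Prod>a\<in>A. \<Prod>b\<in>B. bsign (a < b))"
    unfolding crossing_sign_def by (rule prod.swap)
  also have "\<dots> = (\<Prod>a\<in>A. \<Prod>b\<in>B. (- 1) * bsign (b < a))"
  proof (intro prod.cong refl)
    fix a b assume "a \<in> A" "b \<in> B"
    then have "a \<noteq> b" using assms by auto
    then show "bsign (a < b) = (- 1) * bsign (b < a)" by (auto simp: bsign_def)
  qed
  also have "\<dots> = (- 1) ^ (card A * card B) * crossing_sign A B"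
    by (simp only: prod.distrib prod_constant crossing_sign_def) (simp add: mult.commute flip: power_mult)
  finally show ?thesis .
qed

lemma crossing_sign_singletons: "crossing_sign {a} {b} = bsign (b < a)"
  by (simp add: crossing_sign_def)

lemma polygon_less_disjoint:
  assumes "finite A" "finite B" "A \<noteq> {}" "B \<noteq> {}" "A \<inter> B = {}"
  shows "polygon_less A B \<longleftrightarrow> \<not> polygon_less B A"
proof -
  have "Min A \<in> A" "Min B \<in> B" using assms by simp_all
  then have "Min A \<noteq> Min B" using assms(5) by auto
  then show ?thesis by (auto simp: polygon_less_def)
qed

lemma pair_sign_eq:
  assumes "finite A" "finite B" "A \<noteq> {}" "B \<noteq> {}" "A \<inter> B = {}"
  shows "(if polygon_less A B then crossing_sign A B else 1) *
    (if polygon_less B A then crossing_sign B A else 1) = pair_sign A B"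
  using polygon_less_disjoint[OF assms] crossing_sign_commute[OF assms(5)]
  by (auto simp: pair_sign_def bsign_def minus_one_power_iff)

lemma pair_sign_commute:
  assumes "finite A" "finite B" "A \<noteq> {}" "B \<noteq> {}" "A \<inter> B = {}"
  shows "pair_sign A B = pair_sign B A"
  using pair_sign_eq[of A B] pair_sign_eq[of B A] assms by (simp add: Int_commute mult.commute)

text \<open>Since \<open>pair_sign\<close> absorbs the comparison of minima, a polygon can be split
  off without knowing its place in the order of the polygons. This is what makes the diagrams before
  and after a contraction comparable.\<close>

lemma shuffle_sign_insert:
  assumes "finite K" "P \<notin> K" "finite P" "P \<noteq> {}"
    and "\<And>R. R \<in> K \<Longrightarrow> finite R \<and> R \<noteq> {} \<and> R \<inter> P = {}"
  shows "shuffle_sign (insert P K) = (\<Prod>R\<in>K. pair_sign R P) * shuffle_sign K"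
proof -
  define f where "f = (\<lambda>A B. if polygon_less A B then crossing_sign A B else 1)"
  have "shuffle_sign (insert P K) = f P P * (\<Prod>B\<in>K. f P B) * (\<Prod>A\<in>K. f A P * (\<Prod>B\<in>K. f A B))"
    using assms(1,2) by (simp add: shuffle_sign_def f_def)
  also have "f P P = 1" by (simp add: f_def polygon_less_def)
  also have "1 * (\<Prod>B\<in>K. f P B) * (\<Prod>A\<in>K. f A P * (\<Prod>B\<in>K. f A B)) =
      (\<Prod>R\<in>K. f R P * f P R) * shuffle_sign K"
    by (simp add: prod.distrib shuffle_sign_def f_def mult_ac)
  also have "(\<Prod>R\<in>K. f R P * f P R) = (\<Prod>R\<in>K. pair_sign R P)"
    using assms unfolding f_def by (intro prod.cong refl pair_sign_eq) auto
  finally show ?thesis .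
qed

section \<open>The sign of an edge\<close>

definition position_sign :: "circle set \<Rightarrow> circle \<Rightarrow> int" where
  "position_sign S w = (\<Prod>x\<in>S. bsign (w \<le> x))"

lemma position_sign_square: "position_sign S w * position_sign S w = 1"
  unfolding position_sign_def by (rule prod_bsign_square)

lemma position_sign_remove:
  assumes "finite S" "y \<in> S"
  shows "position_sign (S - {y}) w = position_sign S w * bsign (w \<le> y)"
proof -
  have "position_sign S w = bsign (w \<le> y) * position_sign (S - {y}) w"
    unfolding position_sign_def using assms by (rule prod.remove)
  then show ?thesis by (simp add: mult_ac)
qed

lemma crossing_sign_singleton_right:
  assumes "w \<notin> A"
  shows "crossing_sign A {w} = position_sign A w"
  unfolding crossing_sign_def position_sign_def using assms
  by (intro prod.cong refl) (auto simp: bsign_def less_le)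

text \<open>Linking counts the pairs with \<open>a \<le> b\<close>, crossing those with
  \<open>b < a\<close>. For disjoint sets these are complementary, and the total number of pairs is
  even.\<close>

lemma lk_even_eq_crossing:
  assumes "finite A" "finite B" "A \<inter> B = {}" "even (card A)" "even (card B)"
  shows "lk A B = crossing_sign A B"
proof -
  have "lk A B = (\<Prod>b\<in>B. \<Prod>a\<in>A. bsign (a < b))"
  proof -
    have "a < b \<longleftrightarrow> a \<le> b" if "a \<in> A" "b \<in> B" for a b
      using that assms(3) by (auto simp: less_le)
    then show ?thesis using assms lk_alt[of A B] by (simp add: polygon_def)
  qed
  also have "\<dots> = crossing_sign B A" by (simp add: crossing_sign_def)
  also have "\<dots> = crossing_sign A B" using crossing_sign_commute[of A B] assms by simp
  finally show ?thesis .
qed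

text \<open>The point \<open>Infty\<close> lies above all of \<open>Q\<close>, so only the
  comparison with \<open>v\<close> survives.\<close>

lemma lk_point_Infty:
  assumes "finite Q" "v \<notin> Q" "Infty \<notin> Q" "v \<noteq> Infty"
  shows "lk {v, Infty} Q = position_sign Q v"
proof -
  have "q < Infty" if "q \<in> Q" for q
    using assms(3) that by (cases q) (auto simp: less_circle_def)
  then have "bsign (Infty \<le> q) = 1" if "q \<in> Q" for q
    using that by (simp add: bsign_def not_le)
  then show ?thesis
    using assms by (simp add: lk_alt polygon_def position_sign_def)
qed

text \<open>The factor \<open>position_sign Q w\<close> comes from deleting \<open>v\<close> if
  \<open>P\<close> is odd, and from \<open>E_sign v P Q\<close> if \<open>P\<close> is even.
  Symmetrically, \<open>position_sign P w\<close> comes from deleting \<open>w\<close> or from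
  \<open>E_sign w Q P\<close>. If both polygons are odd, reversing the pairs between
  \<open>v\<close> and \<open>Q\<close> costs one further sign.\<close>

lemma linking_factors_eq:
  assumes fin: "finite P" "finite Q" and disj: "P \<inter> Q = {}" and v: "v \<in> P" and w: "w \<in> Q"
    and vw: "v < w" and gap: "\<And>x. x \<in> P \<union> Q \<Longrightarrow> \<not> (v < x \<and> x < w)"
    and inf: "Infty \<notin> P" "Infty \<notin> Q"
  shows "lk (even_part v P) (even_part w Q) * E_sign v P Q * E_sign w Q P =
    bsign (odd (card P) \<and> odd (card Q)) * crossing_sign P Q * position_sign (P \<union> Q) w"
proof -
  have vn: "v \<notin> Q" "w \<notin> P" "v \<noteq> Infty" "w \<noteq> Infty"
    using disj v w inf by auto
  have pU: "position_sign (P \<union> Q) w = position_sign P w * position_sign Q w"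
    unfolding position_sign_def using fin disj by (intro prod.union_disjoint) auto
  \<comment> \<open>No point of \<open>Q\<close> lies on the edge other than \<open>w\<close>, so
    counting from \<open>v\<close> or from \<open>w\<close> gives the same number.\<close>
  have pQ: "position_sign Q v = position_sign Q w"
  proof -
    have "v \<le> x \<longleftrightarrow> w \<le> x" if "x \<in> Q" for x
      using that gap[of x] vn vw by (auto simp: not_less)
    then show ?thesis by (simp add: position_sign_def)
  qed
  have XP: "crossing_sign P {w} = position_sign P w"
    using vn by (simp add: crossing_sign_singleton_right)
  have XQ: "crossing_sign {v} Q = (- 1) ^ card Q * position_sign Q w"
    using crossing_sign_commute[of Q "{v}"] crossing_sign_singleton_right[of v Q] vn pQ by simp
  have X: "crossing_sign {v} {w} = 1"
    using vw by (auto simp: crossing_sign_singletons bsign_def)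
  have E: "E_sign v P Q = (if even (card P) then position_sign Q w else 1)"
    "E_sign w Q P = (if even (card Q) then position_sign P w else 1)"
    using lk_point_Infty[of Q v] lk_point_Infty[of P w] fin vn inf pQ by (auto simp: E_sign_def)
  have L: "lk (even_part v P) (even_part w Q) = crossing_sign (even_part v P) (even_part w Q)"
    by (rule lk_even_eq_crossing) (use fin disj v w in \<open>auto simp: even_part_def\<close>)
  have XX: "crossing_sign (P - {v}) Q = crossing_sign P Q * crossing_sign {v} Q"
    "crossing_sign P (Q - {w}) = crossing_sign P Q * crossing_sign P {w}"
    "crossing_sign (P - {v}) (Q - {w}) =
      crossing_sign P Q * crossing_sign P {w} * crossing_sign {v} Q * crossing_sign {v} {w}"
    using fin v w by (simp_all add: crossing_sign_remove_left crossing_sign_remove_right)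
  show ?thesis
    unfolding L E pU unfolding even_part_def
    by (cases "even (card P)"; cases "even (card Q)") (simp_all add: XX XP XQ X bsign_def)
qed

lemma admissible_edgeE:
  assumes "leaf_diagram L" "(v, w) \<in> admissible_edges L"
  obtains P Q where "P \<in> L" "Q \<in> L" "v \<in> P" "w \<in> Q" "P \<noteq> Q" "v < w"
    "{v<..<w} \<inter> leaves L = {}" "polygon_of L v = P" "polygon_of L w = Q"
    "contract L (v, w) = insert (P \<union> Q - {w}) (L - {P, Q})"
proof -
  have e: "v \<in> leaves L" "w \<in> leaves L" "v < w" "{v<..<w} \<inter> leaves L = {}"
    "polygon_of L v \<noteq> polygon_of L w"
    using assms by (auto simp: admissible_edges_def edges_def)
  obtain P Q where PQ: "P \<in> L" "v \<in> P" "Q \<in> L" "w \<in> Q" using e by auto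
  then have eq: "polygon_of L v = P" "polygon_of L w = Q" using assms polygon_of_eq by auto
  show thesis
    by (rule that[of P Q]) (use e PQ eq in \<open>auto simp: contract_def merged_polygon_def\<close>)
qed

lemma Odd_sign_alt:
  "finite L \<Longrightarrow> Odd_sign P L =
    (\<Prod>R\<in>L. bsign (odd (card R) \<and> odd (card P) \<and> polygon_less P R))"
  unfolding Odd_sign_def
  by (auto simp: bsign_def Int_def intro!: prod.mono_neutral_cong_left)

text \<open>The crossings of a third polygon with \<open>P\<close>, \<open>Q\<close> and the merged
  polygon cancel, except for those with the deleted leaf \<open>w\<close>; the order corrections in
  its pair signs are what the \<open>Odd\<close> factors record. The pair \<open>P\<close>,
  \<open>Q\<close> itself accounts for the local sign.\<close>

lemma edge_sign_eq:
  assumes L: "leaf_diagram L" and e: "(v, w) \<in> admissible_edges L"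
  shows "edge_sign L (v, w) =
    shuffle_sign L * shuffle_sign (contract L (v, w)) * position_sign (leaves L) w"
proof -
  obtain P Q where PQ: "P \<in> L" "Q \<in> L" "v \<in> P" "w \<in> Q" "P \<noteq> Q" "v < w"
    and gap: "{v<..<w} \<inter> leaves L = {}" and pol: "polygon_of L v = P" "polygon_of L w = Q"
    and con: "contract L (v, w) = insert (P \<union> Q - {w}) (L - {P, Q})"
    using admissible_edgeE[OF L e] by metis
  define K where "K = L - {P, Q}"
  define M where "M = P \<union> Q - {w}"
  have LK: "L = insert P (insert Q K)" and nK: "P \<notin> K" "Q \<notin> K" "finite K"
    using PQ leaf_diagramD(1)[OF L] by (auto simp: K_def)
  have fin: "finite P" "finite Q" "finite M" and disj: "P \<inter> Q = {}"
    and inf: "Infty \<notin> P" "Infty \<notin> Q" and ne: "P \<noteq> {}" "Q \<noteq> {}" "M \<noteq> {}"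
    using PQ leaf_diagramD[OF L] by (auto simp: M_def)
  have R: "finite R \<and> R \<noteq> {} \<and> R \<inter> P = {} \<and> R \<inter> Q = {} \<and> R \<inter> M = {} \<and> w \<notin> R"
    if "R \<in> K" for R
  proof -
    have "R \<in> L" "R \<noteq> P" "R \<noteq> Q" using that by (auto simp: K_def)
    then have "finite R" "R \<noteq> {}" "R \<inter> P = {}" "R \<inter> Q = {}"
      using leaf_diagramD[OF L] PQ(1,2) by auto
    then show ?thesis using PQ by (auto simp: M_def)
  qed
  have "M \<notin> K" using R ne by auto
  define odd_less where
    "odd_less = (\<lambda>A B. bsign (odd (card B) \<and> odd (card A) \<and> polygon_less A B))"
  \<comment> \<open>\<open>G\<close> collects the \<open>Odd\<close> contributions of the third
    polygons. It appears in the global sign and again in the product of the two shuffle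
    signs.\<close>
  define G where "G = (\<Prod>R\<in>K. odd_less P R * odd_less Q R * odd_less M R)"
  have pl: "polygon_less Q P \<longleftrightarrow> \<not> polygon_less P Q"
    using polygon_less_disjoint fin ne disj by blast
  have glo: "global_sign L (v, w) = bsign (odd (card P) \<and> odd (card Q)) * G"
  proof -
    have "global_sign L (v, w) = Odd_sign P L * Odd_sign Q L * Odd_sign M (insert M K)"
      using con by (simp add: global_sign_def pol merged_polygon_def M_def K_def)
    also have "\<dots> = (odd_less P P * odd_less Q Q * odd_less M M) * (odd_less P Q * odd_less Q P) * G"
      using nK fin PQ(5) \<open>M \<notin> K\<close>
      by (simp add: LK Odd_sign_alt odd_less_def G_def prod.distrib mult_ac)
    also have "odd_less P P * odd_less Q Q * odd_less M M = 1"
      by (simp add: odd_less_def polygon_less_def bsign_def)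
    \<comment> \<open>Exactly one of the two polygons precedes the other, so one of these factors is
      -1 precisely when both are odd.\<close>
    also have "odd_less P Q * odd_less Q P = bsign (odd (card P) \<and> odd (card Q))"
      by (auto simp: odd_less_def bsign_def pl)
    finally show ?thesis by simp
  qed
  have shuffle: "shuffle_sign L * shuffle_sign (contract L (v, w)) =
      pair_sign P Q * G * (\<Prod>R\<in>K. position_sign R w)"
  proof -
    have "shuffle_sign L = pair_sign P Q * (\<Prod>R\<in>K. pair_sign R P) *
        (\<Prod>R\<in>K. pair_sign R Q) * shuffle_sign K"
    proof -
      have "shuffle_sign L = (\<Prod>R\<in>insert Q K. pair_sign R P) * shuffle_sign (insert Q K)"
        unfolding LK using nK fin ne R PQ(5) disj by (intro shuffle_sign_insert) auto
      moreover have "shuffle_sign (insert Q K) = (\<Prod>R\<in>K. pair_sign R Q) * shuffle_sign K"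
        using nK fin ne R by (intro shuffle_sign_insert) auto
      ultimately show ?thesis
        using nK pair_sign_commute[of P Q] fin ne disj by (simp add: mult_ac)
    qed
    moreover have "shuffle_sign (contract L (v, w)) = (\<Prod>R\<in>K. pair_sign R M) * shuffle_sign K"
      unfolding con K_def[symmetric] M_def[symmetric]
      using nK fin ne R \<open>M \<notin> K\<close> by (intro shuffle_sign_insert) auto
    \<comment> \<open>Adding \<open>w\<close> back to the merged polygon gives
      \<open>P \<union> Q\<close>, so all crossings with \<open>R\<close> occur twice, apart from
      those with \<open>w\<close>.\<close>
    moreover have "pair_sign R P * pair_sign R Q * pair_sign R M =
        odd_less P R * odd_less Q R * odd_less M R * position_sign R w" if "R \<in> K" for R
    proof -
      have "crossing_sign R M = crossing_sign R (P \<union> Q) * crossing_sign R {w}"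
        unfolding M_def using fin PQ by (intro crossing_sign_remove_right) auto
      then have "crossing_sign R M = crossing_sign R P * crossing_sign R Q * position_sign R w"
        using fin disj R[OF that] by (simp add: crossing_sign_Un_right crossing_sign_singleton_right)
      moreover have "(crossing_sign R P * crossing_sign R P) * (crossing_sign R Q * crossing_sign R Q) = 1"
        by (simp add: crossing_sign_square)
      ultimately have "crossing_sign R P * crossing_sign R Q * crossing_sign R M = position_sign R w"
        by (simp add: mult_ac)
      then show ?thesis
        by (simp add: pair_sign_def odd_less_def mult_ac)
    qed
    then have "(\<Prod>R\<in>K. pair_sign R P) * (\<Prod>R\<in>K. pair_sign R Q) * (\<Prod>R\<in>K. pair_sign R M) =
        G * (\<Prod>R\<in>K. position_sign R w)"
      by (simp add: G_def flip: prod.distrib)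
    ultimately show ?thesis
      using shuffle_sign_square[of K] by (simp add: mult_ac)
  qed
  have pos: "position_sign (leaves L) w = position_sign (P \<union> Q) w * (\<Prod>R\<in>K. position_sign R w)"
  proof -
    have "leaves L = (P \<union> Q) \<union> \<Union>K" by (auto simp: LK)
    moreover have "position_sign ((P \<union> Q) \<union> \<Union>K) w = position_sign (P \<union> Q) w * position_sign (\<Union>K) w"
      unfolding position_sign_def using fin nK R by (intro prod.union_disjoint) blast+
    moreover have "position_sign (\<Union>K) w = (\<Prod>R\<in>K. position_sign R w)"
    proof -
      have "\<forall>A\<in>K. \<forall>B\<in>K. A \<noteq> B \<longrightarrow> A \<inter> B = {}"
        using leaf_diagramD(5)[OF L] by (auto simp: K_def)
      then show ?thesis
        unfolding position_sign_def using R by (subst prod.Union_disjoint) auto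
    qed
    ultimately show ?thesis by simp
  qed
  \<comment> \<open>For odd polygons \<open>bsign (v < w)\<close> is -1 and turns the sign of
    \<open>polygon_less P Q\<close> into that of \<open>polygon_less Q P\<close>. Hence
    \<open>psi_sign\<close> is the Koszul factor of \<open>pair_sign P Q\<close>.\<close>
  have "position_sign (P \<union> Q) w * bsign (odd (card P) \<and> odd (card Q)) * psi_sign L (v, w) *
      crossing_sign P Q * bsign (odd (card P) \<and> odd (card Q)) = pair_sign P Q * position_sign (P \<union> Q) w"
    using PQ(6) pl by (auto simp: psi_sign_def pol pair_sign_def bsign_def)
  moreover have "lk (even_part v P) (even_part w Q) * E_sign v P Q * E_sign w Q P =
      bsign (odd (card P) \<and> odd (card Q)) * crossing_sign P Q * position_sign (P \<union> Q) w"
  proof (rule linking_factors_eq)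
    show "\<not> (v < x \<and> x < w)" if "x \<in> P \<union> Q" for x
      using gap that PQ by auto
  qed (use fin disj PQ inf in auto)
  ultimately have "local_sign L (v, w) * bsign (odd (card P) \<and> odd (card Q)) =
      pair_sign P Q * position_sign (P \<union> Q) w"
    by (simp add: local_sign_def lk_edge_def pol mult_ac)
  \<comment> \<open>The parity factor beside the local sign is the one with which \<open>glo\<close>
    begins.\<close>
  then have "edge_sign L (v, w) = (pair_sign P Q * position_sign (P \<union> Q) w) * G"
    by (simp only: edge_sign_def glo mult.assoc [symmetric])
  moreover have "(\<Prod>R\<in>K. position_sign R w) * (\<Prod>R\<in>K. position_sign R w) = 1"
    by (simp add: position_sign_square flip: prod.distrib)
  ultimately show ?thesis
    unfolding shuffle pos by (simp add: mult_ac)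
qed

section \<open>Contractions of two edges commute\<close>

lemma
  assumes L: "leaf_diagram L" and e: "(v, w) \<in> admissible_edges L"
  shows leaf_diagram_contract: "leaf_diagram (contract L (v, w))"
    and leaves_contract: "leaves (contract L (v, w)) = leaves L - {w}"
    and gauss_degree_contract: "gauss_degree (contract L (v, w)) = gauss_degree L"
    and codimension_contract: "codimension (contract L (v, w)) = codimension L + 1"
proof -
  obtain P Q where PQ: "P \<in> L" "Q \<in> L" "v \<in> P" "w \<in> Q" "P \<noteq> Q" "v < w"
    and con: "contract L (v, w) = insert (P \<union> Q - {w}) (L - {P, Q})"
    using admissible_edgeE[OF L e] by metis
  have disj: "A \<inter> B = {}" if "A \<in> L" "B \<in> L" "A \<noteq> B" for A B
    using leaf_diagramD(5)[OF L that] .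
  have "v \<noteq> w" using PQ by auto
  show LD: "leaf_diagram (contract L (v, w))"
    unfolding leaf_diagram_def con
  proof (intro conjI)
    show "disjoint (insert (P \<union> Q - {w}) (L - {P, Q}))"
      using disj PQ(1,2) unfolding disjoint_def by blast
    show "\<forall>R\<in>insert (P \<union> Q - {w}) (L - {P, Q}). polygon R \<and> R \<noteq> {} \<and> Infty \<notin> R"
      using leaf_diagramD[OF L] PQ \<open>v \<noteq> w\<close> by (auto simp: polygon_def)
  qed (use leaf_diagramD(1)[OF L] in auto)
  show lv: "leaves (contract L (v, w)) = leaves L - {w}"
  proof -
    have "w \<notin> R" if "R \<in> L - {P, Q}" for R
      using disj[of R Q] that PQ by auto
    then show ?thesis using PQ unfolding con by blast
  qed
  have "w \<in> leaves L" using PQ by auto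
  then have "card (leaves L) = Suc (card (leaves (contract L (v, w))))"
    unfolding lv by (rule card_Suc_Diff1[OF finite_leaves[OF L], symmetric])
  then have 1: "int (card (leaves (contract L (v, w)))) = int (card (leaves L)) - 1" by linarith
  \<comment> \<open>The leaf \<open>v\<close> survives and belongs to no polygon other than
    \<open>P\<close>, so the merged polygon is not already among the remaining ones and the count
    drops by exactly one.\<close>
  have "v \<in> P \<union> Q - {w}" using PQ \<open>v \<noteq> w\<close> by auto
  then have "P \<union> Q - {w} \<notin> L - {P, Q}"
    using disj[of _ P] PQ(1,3) by blast
  then have "card (contract L (v, w)) = Suc (card (L - {P, Q}))"
    using leaf_diagramD(1)[OF L] unfolding con by simp
  moreover have "card (L - {P, Q}) = card L - 2" "2 \<le> card L"
    using card_Diff_subset[of "{P, Q}" L] card_mono[of L "{P, Q}"] PQ(1,2,5) leaf_diagramD(1)[OF L]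
    by simp_all
  ultimately have 2: "int (card (contract L (v, w))) = int (card L) - 1" by linarith
  show "gauss_degree (contract L (v, w)) = gauss_degree L"
    "codimension (contract L (v, w)) = codimension L + 1"
    by (simp_all add: gauss_degree_def codimension_def 1 2)
qed

section \<open>Leaf diagrams as equivalence relations on their leaves\<close>

definition same_colour :: "circle set set \<Rightarrow> circle \<Rightarrow> circle \<Rightarrow> bool" where
  "same_colour L a b \<longleftrightarrow> (\<exists>P\<in>L. a \<in> P \<and> b \<in> P)"

text \<open>A polygon is nonempty and is the full class of any of its points. Points that are not
  leaves are not even related to themselves, so the relation also determines the set of
  leaves.\<close>

lemma leaf_diagram_eqI:
  assumes "leaf_diagram L" "leaf_diagram L'" "\<And>a b. same_colour L a b = same_colour L' a b"
  shows "L = L'"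
proof -
  have sub: "L \<subseteq> L'" if L: "leaf_diagram L" "leaf_diagram L'"
    and eq: "\<And>a b. same_colour L a b = same_colour L' a b" for L L'
  proof
    fix P assume P: "P \<in> L"
    then obtain a where a: "a \<in> P" using leaf_diagramD(3)[OF L(1)] by auto
    then have "same_colour L' a a" using P eq by (auto simp: same_colour_def)
    then obtain Q where Q: "Q \<in> L'" "a \<in> Q" by (auto simp: same_colour_def)
    have "P = {b. same_colour L a b}"
      using leaf_diagramD(5)[OF L(1)] P a unfolding same_colour_def by blast
    moreover have "Q = {b. same_colour L' a b}"
      using leaf_diagramD(5)[OF L(2)] Q unfolding same_colour_def by blast
    ultimately show "P \<in> L'" using Q eq by simp
  qed
  show ?thesis using sub[of L L'] sub[of L' L] assms by auto
qed

lemma same_colour_polygon_of: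
  assumes "leaf_diagram L" "a \<in> leaves L" "b \<in> leaves L"
  shows "same_colour L a b \<longleftrightarrow> polygon_of L a = polygon_of L b"
proof -
  obtain P Q where "P \<in> L" "a \<in> P" "Q \<in> L" "b \<in> Q" using assms by auto
  then show ?thesis
    unfolding same_colour_def by (metis polygon_of_eq[OF assms(1)])
qed

text \<open>Writing the relation as equality of values of a function makes reflexivity, symmetry and
  transitivity automatic in the later first-order arguments about fused classes.\<close>

lemma colouring:
  assumes L: "leaf_diagram L"
  obtains c :: "circle \<Rightarrow> nat"
  where "\<And>a b. same_colour L a b \<longleftrightarrow> a \<in> leaves L \<and> b \<in> leaves L \<and> c a = c b"
proof -
  obtain g :: "circle set \<Rightarrow> nat" where g: "inj_on g L"
    using finite_imp_inj_to_nat_seg[OF leaf_diagramD(1)[OF L]] by auto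
  have mem: "polygon_of L a \<in> L" if "a \<in> leaves L" for a
    using that polygon_of_eq[OF L] by auto
  have "same_colour L a b \<longleftrightarrow>
      a \<in> leaves L \<and> b \<in> leaves L \<and> g (polygon_of L a) = g (polygon_of L b)" for a b
  proof (cases "a \<in> leaves L \<and> b \<in> leaves L")
    case True
    then show ?thesis
      using same_colour_polygon_of[OF L] inj_on_eq_iff[OF g] mem by simp
  next
    case False
    then show ?thesis by (auto simp: same_colour_def)
  qed
  then show thesis by (rule that)
qed

lemma admissible_edges_iff:
  assumes "leaf_diagram L"
  shows "(v, w) \<in> admissible_edges L \<longleftrightarrow> v \<in> leaves L \<and> w \<in> leaves L \<and> v < w \<and>
    (\<forall>x\<in>leaves L. \<not> (v < x \<and> x < w)) \<and> \<not> same_colour L v w"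
  using same_colour_polygon_of[OF assms, of v w]
  by (auto simp: admissible_edges_def edges_def)

text \<open>The contraction fuses the classes of \<open>v\<close> and \<open>w\<close> and then
  deletes \<open>w\<close>.\<close>

lemma same_colour_contract:
  assumes L: "leaf_diagram L" and e: "(v, w) \<in> admissible_edges L"
  shows "same_colour (contract L (v, w)) a b \<longleftrightarrow> a \<noteq> w \<and> b \<noteq> w \<and>
    (same_colour L a b \<or>
      (same_colour L a v \<or> same_colour L a w) \<and> (same_colour L b v \<or> same_colour L b w))"
proof -
  obtain P Q where PQ: "P \<in> L" "Q \<in> L" "v \<in> P" "w \<in> Q" "P \<noteq> Q" "v < w"
    and con: "contract L (v, w) = insert (P \<union> Q - {w}) (L - {P, Q})"
    using admissible_edgeE[OF L e] by metis
  have v: "same_colour L c v \<longleftrightarrow> c \<in> P" for c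
    using PQ leaf_diagramD(5)[OF L] unfolding same_colour_def by blast
  have w: "same_colour L c w \<longleftrightarrow> c \<in> Q" for c
    using PQ leaf_diagramD(5)[OF L] unfolding same_colour_def by blast
  have "w \<notin> R" if "R \<in> L - {P, Q}" for R
    using leaf_diagramD(5)[OF L, of R Q] that PQ by auto
  moreover have "same_colour L a b \<longleftrightarrow>
      a \<in> P \<and> b \<in> P \<or> a \<in> Q \<and> b \<in> Q \<or> (\<exists>R\<in>L - {P, Q}. a \<in> R \<and> b \<in> R)"
    using PQ by (auto simp: same_colour_def)
  moreover have "same_colour (contract L (v, w)) a b \<longleftrightarrow>
      a \<noteq> w \<and> b \<noteq> w \<and> (a \<in> P \<or> a \<in> Q) \<and> (b \<in> P \<or> b \<in> Q) \<or>
      (\<exists>R\<in>L - {P, Q}. a \<in> R \<and> b \<in> R)"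
    unfolding same_colour_def con by (simp add: conj_ac)
  ultimately show ?thesis
    unfolding v w by metis
qed

text \<open>The lower end must be the nearest leaf below the upper end.\<close>

lemma snd_inj_on_admissible_edges:
  assumes "leaf_diagram L"
  shows "inj_on snd (admissible_edges L)"
proof (rule inj_onI)
  fix e f assume ef: "e \<in> admissible_edges L" "f \<in> admissible_edges L" "snd e = snd f"
  obtain v v' w where "e = (v, w)" "f = (v', w)"
    using ef(3) by (metis prod.collapse)
  with ef show "e = f"
    by (cases v v' rule: linorder_cases) (auto simp: admissible_edges_iff[OF assms])
qed

section \<open>Fusing classes and exchanging two contractions\<close>

definition join_classes :: "'a \<Rightarrow> 'a \<Rightarrow> ('a \<Rightarrow> 'a \<Rightarrow> bool) \<Rightarrow> 'a \<Rightarrow> 'a \<Rightarrow> bool" where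
  "join_classes p q E a b \<longleftrightarrow> E a b \<or> (E a p \<or> E a q) \<and> (E b p \<or> E b q)"

text \<open>Both sides are the equivalence relation generated by the kernel of \<open>c\<close> and
  the two pairs.\<close>

lemma join_classes_commute:
  "join_classes p q (join_classes r s (\<lambda>a b. c a = c b)) a b \<longleftrightarrow>
    join_classes r s (join_classes p q (\<lambda>a b. c a = c b)) a b"
  unfolding join_classes_def by (smt (verit))

text \<open>Both sides fuse the classes of \<open>p\<close>, \<open>q\<close> and \<open>r\<close>
  into one. This covers adjacent edges, where exchanging the contractions changes a lower
  end.\<close>

lemma join_classes_chain:
  "join_classes p q (join_classes q r (\<lambda>a b. c a = c b)) a b \<longleftrightarrow>
    join_classes p r (join_classes p q (\<lambda>a b. c a = c b)) a b"
  unfolding join_classes_def by (smt (verit))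

text \<open>An edge is determined by its greater end, which is the leaf removed by the contraction.
Contracting \<open>(v, w)\<close> and then \<open>(x, y)\<close> removes \<open>w\<close> and then \<open>y\<close>; the map below describes
the pair of edges that removes \<open>y\<close> first. The lower ends change if the two
edges are adjacent in the diagram.\<close>

fun swap_edges :: "(circle \<times> circle) \<times> circle \<times> circle \<Rightarrow> (circle \<times> circle) \<times> circle \<times> circle" where
  "swap_edges ((v, w), (x, y)) =
     ((if x = v \<and> w < y then w else x, y), (if v = y then x else v, w))"

text \<open>Deleting a leaf changes adjacency only next to that leaf, which leaves three
  configurations. In each of them both orders delete \<open>w\<close> and \<open>y\<close> and fuse
  the same classes.\<close>

lemma swap_edges:
  assumes L: "leaf_diagram L" and e: "(v, w) \<in> admissible_edges L"
    and f: "(x', y) \<in> admissible_edges (contract L (v, w))"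
    and sw: "swap_edges ((v, w), (x', y)) = ((x, y), (v', w))"
  shows "(x, y) \<in> admissible_edges L" "(v', w) \<in> admissible_edges (contract L (x, y))"
    "contract (contract L (x, y)) (v', w) = contract (contract L (v, w)) (x', y)" "y \<noteq> w"
proof -
  define V where "V = leaves L"
  obtain c :: "circle \<Rightarrow> nat" where
    S: "\<And>a b. same_colour L a b \<longleftrightarrow> a \<in> V \<and> b \<in> V \<and> c a = c b"
    using colouring[OF L] unfolding V_def by metis
  note adm = admissible_edges_iff[OF L, folded V_def, unfolded S]
  note L1 = leaf_diagram_contract[OF L e]
  note S1 = same_colour_contract[OF L e, unfolded S]
  have e': "v \<in> V" "w \<in> V" "v < w" "c v \<noteq> c w"
    and ev: "\<And>z. z \<in> V \<Longrightarrow> z \<le> v \<or> w \<le> z"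
    using e unfolding adm by (auto simp: not_less)
  have f': "x' \<in> V" "x' \<noteq> w" "y \<in> V" "y \<noteq> w" "x' < y" "c x' \<noteq> c y"
    "\<not> ((c x' = c v \<or> c x' = c w) \<and> (c y = c v \<or> c y = c w))"
    and fv: "\<And>z. z \<in> V \<Longrightarrow> z \<noteq> w \<Longrightarrow> z \<le> x' \<or> y \<le> z"
    using f e' unfolding admissible_edges_iff[OF L1] leaves_contract[OF L e, folded V_def] S1
    by (auto simp: not_less)
  show "y \<noteq> w" by fact
  have x: "x = (if x' = v \<and> w < y then w else x')" and v': "v' = (if v = y then x' else v)"
    using sw by simp_all
  \<comment> \<open>The leaf \<open>y\<close> lies above \<open>v\<close>, differs from
    \<open>w\<close>, and cannot lie between them.\<close>
  have wy: "w < y" if "x' = v"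
    using ev[of y] f'(3-5) that by (metis leD le_neq_trans)
  \<comment> \<open>In case \<open>above\<close>, \<open>w\<close> separates \<open>v\<close> from
    \<open>y\<close> in \<open>L\<close>, so the edge of \<open>L\<close> ending at \<open>y\<close>
    starts at \<open>w\<close>. In case \<open>below\<close>, removing \<open>y = v\<close> first
    makes \<open>x'\<close> the lower neighbour of \<open>w\<close>. In case \<open>apart\<close>
    the edges share no end.\<close>
  consider (above) "x' = v" "x = w" "v' = v" "w < y" "v \<noteq> y"
    | (below) "x' \<noteq> v" "v = y" "x = x'" "v' = x'"
    | (apart) "x' \<noteq> v" "v \<noteq> y" "x = x'" "v' = v"
    using x v' wy f'(5) by (cases "x' = v"; cases "v = y") simp_all
  note cases = this
  from cases have *: "x \<in> V \<and> x < y \<and> c x \<noteq> c y \<and> (\<forall>z\<in>V. \<not> (x < z \<and> z < y)) \<and>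
      v' \<in> V \<and> v' \<noteq> y \<and> v' < w \<and> c v' \<noteq> c w \<and>
      \<not> ((c v' = c x \<or> c v' = c y) \<and> (c w = c x \<or> c w = c y)) \<and>
      (\<forall>z\<in>V. z \<noteq> y \<longrightarrow> \<not> (v' < z \<and> z < w))"
  proof cases
    case above
    have "\<not> (w < z \<and> z < y)" if "z \<in> V" for z
      using fv[OF that] above e'(3) by (cases "z = w") auto
    moreover have "\<not> (v < z \<and> z < w)" if "z \<in> V" for z
      using ev[OF that] by auto
    ultimately show ?thesis using above e' f' by auto
  next
    case below
    have "\<not> (x' < z \<and> z < y)" if "z \<in> V" for z
      using fv[OF that] below e'(3) by (cases "z = w") auto
    moreover have "\<not> (x' < z \<and> z < w)" if "z \<in> V" "z \<noteq> y" for z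
      using ev[OF that(1)] fv[OF that(1)] below that(2) by (cases "z = w") auto
    ultimately show ?thesis using below e' f' by auto
  next
    case apart
    \<comment> \<open>If \<open>w\<close> lay between \<open>x'\<close> and \<open>y\<close>, its
      lower neighbour \<open>v\<close> would have to be \<open>x'\<close>.\<close>
    have "\<not> (x' < w \<and> w < y)"
      using fv[of v] ev[of x'] e'(1,3) f'(1) apart by (cases "v = w") auto
    then have "\<not> (x' < z \<and> z < y)" if "z \<in> V" for z
      using fv[OF that] by (cases "z = w") auto
    moreover have "\<not> (v < z \<and> z < w)" if "z \<in> V" for z
      using ev[OF that] by auto
    ultimately show ?thesis using apart e' f' by auto
  qed
  show f2: "(x, y) \<in> admissible_edges L"
    unfolding adm using * f' by auto
  note L2 = leaf_diagram_contract[OF L f2]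
  note S2 = same_colour_contract[OF L f2, unfolded S]
  show e2: "(v', w) \<in> admissible_edges (contract L (x, y))"
    unfolding admissible_edges_iff[OF L2] leaves_contract[OF L f2, folded V_def] S2
    using * e' f' by auto
  show "contract (contract L (x, y)) (v', w) = contract (contract L (v, w)) (x', y)"
  proof (rule leaf_diagram_eqI)
    show "leaf_diagram (contract (contract L (x, y)) (v', w))"
      by (rule leaf_diagram_contract[OF L2 e2])
    show "leaf_diagram (contract (contract L (v, w)) (x', y))"
      by (rule leaf_diagram_contract[OF L1 f])
    show "same_colour (contract (contract L (x, y)) (v', w)) a b =
        same_colour (contract (contract L (v, w)) (x', y)) a b" for a b
    \<comment> \<open>Off the surviving leaves both relations are false; on them they are iterated
      \<open>join_classes\<close> of the colouring.\<close>
    proof (cases "a \<in> V \<and> b \<in> V \<and> a \<notin> {w, y} \<and> b \<notin> {w, y}")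
      case False
      then show ?thesis
        unfolding same_colour_contract[OF L2 e2] same_colour_contract[OF L1 f] S1 S2 by auto
    next
      case True
      have VV: "x \<in> V" "y \<in> V" "v \<in> V" "w \<in> V" "v' \<in> V" "x' \<in> V"
        "y \<noteq> w" "v' \<noteq> y" "v' \<noteq> w" "x' \<noteq> w" "x' \<noteq> y"
        using * e' f' by auto
      from cases have "join_classes v' w (join_classes x y (\<lambda>a b. c a = c b)) a b \<longleftrightarrow>
          join_classes x' y (join_classes v w (\<lambda>a b. c a = c b)) a b"
      proof cases
        case above
        then show ?thesis by (simp only: join_classes_chain[of v w y])
      next
        case below
        then show ?thesis by (simp only: join_classes_chain[of x' y w])
      next
        case apart
        then show ?thesis by (simp only: join_classes_commute[of v w])
      qed
      then show ?thesis
        unfolding same_colour_contract[OF L2 e2] same_colour_contract[OF L1 f] S1 S2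
        using True VV by (simp add: join_classes_def)
    qed
  qed
qed

text \<open>In each product the shuffle sign of the intermediate diagram occurs twice and cancels.
  What differs is whether \<open>w\<close> is counted from \<open>y\<close> or \<open>y\<close> from
  \<open>w\<close>, and exactly one of these happens.\<close>

lemma edge_sign_swap:
  assumes L: "leaf_diagram L" and e: "(v, w) \<in> admissible_edges L"
    and f: "(x', y) \<in> admissible_edges (contract L (v, w))"
    and sw: "swap_edges ((v, w), (x', y)) = ((x, y), (v', w))"
  shows "edge_sign L (x, y) * edge_sign (contract L (x, y)) (v', w) =
    - (edge_sign L (v, w) * edge_sign (contract L (v, w)) (x', y))"
proof -
  note s = swap_edges[OF L e f sw]
  have lv: "w \<in> leaves L" "y \<in> leaves L" "finite (leaves L)"
    using e s(1) finite_leaves[OF L] by (auto simp: admissible_edges_iff[OF L])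
  let ?s = shuffle_sign and ?p = "position_sign (leaves L)"
  let ?L1 = "contract L (v, w)" and ?L2 = "contract L (x, y)"
  let ?M = "contract (contract L (v, w)) (x', y)"
  note L1 = leaf_diagram_contract[OF L e] and L2 = leaf_diagram_contract[OF L s(1)]
  have E1: "edge_sign L (v, w) = ?s L * ?s ?L1 * ?p w"
    "edge_sign ?L1 (x', y) = ?s ?L1 * ?s ?M * (?p y * bsign (y \<le> w))"
    unfolding edge_sign_eq[OF L e] edge_sign_eq[OF L1 f] leaves_contract[OF L e]
      position_sign_remove[OF lv(3,1)] by (rule refl)+
  have E2: "edge_sign L (x, y) = ?s L * ?s ?L2 * ?p y"
    "edge_sign ?L2 (v', w) = ?s ?L2 * ?s ?M * (?p w * bsign (w \<le> y))"
    unfolding edge_sign_eq[OF L s(1)] edge_sign_eq[OF L2 s(2)] leaves_contract[OF L s(1)] s(3)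
      position_sign_remove[OF lv(3,2)] by (rule refl)+
  have "edge_sign L (v, w) * edge_sign ?L1 (x', y) =
      ?s L * ?s ?M * ?p w * ?p y * bsign (y \<le> w) * (?s ?L1 * ?s ?L1)"
    unfolding E1 by (simp only: mult_ac)
  moreover have "edge_sign L (x, y) * edge_sign ?L2 (v', w) =
      ?s L * ?s ?M * ?p w * ?p y * bsign (w \<le> y) * (?s ?L2 * ?s ?L2)"
    unfolding E2 by (simp only: mult_ac)
  moreover have "bsign (w \<le> y) = - bsign (y \<le> w)"
    using s(4) by (auto simp: bsign_def)
  ultimately show ?thesis by (simp add: shuffle_sign_square)
qed

section \<open>Cancellation in the double sum\<close>

lemma frag_eq_minus_imp_zero:
  fixes x :: "'a \<Rightarrow>\<^sub>0 int"
  assumes "x = - x"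
  shows "x = 0"
proof (rule poly_mapping_eqI)
  fix k
  have "Poly_Mapping.lookup x k = Poly_Mapping.lookup (- x) k" using assms by (rule arg_cong)
  then show "Poly_Mapping.lookup x k = Poly_Mapping.lookup 0 k" by (simp add: lookup_uminus)
qed

text \<open>The sum runs over pairs of successive contractions, and \<open>swap_edges\<close> is an
  involution on these pairs that preserves the final diagram and reverses the sign.\<close>

lemma coboundary_square_zero:
  assumes L: "leaf_diagram L"
  shows "(\<Sum>e\<in>admissible_edges L. frag_cmul (edge_sign L e) (diagram_coboundary (contract L e))) = 0"
proof -
  define D where "D = Sigma (admissible_edges L) (\<lambda>e. admissible_edges (contract L e))"
  define T where "T = (\<lambda>(e, f). frag_cmul (edge_sign L e * edge_sign (contract L e) f)
    (frag_of (leaf_class (contract (contract L e) f))))"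
  have swap: "swap_edges p \<in> D \<and> swap_edges (swap_edges p) = p \<and> T (swap_edges p) = - T p"
    if p: "p \<in> D" for p
  proof -
    obtain e f where ef: "p = (e, f)" by (rule prod.exhaust)
    obtain v w where vw: "e = (v, w)" by (rule prod.exhaust)
    obtain x' y where "f = (x', y)" by (rule prod.exhaust)
    with ef vw have pe: "p = ((v, w), (x', y))" by simp
    define x where "x = (if x' = v \<and> w < y then w else x')"
    define v' where "v' = (if v = y then x' else v)"
    have sw: "swap_edges ((v, w), (x', y)) = ((x, y), (v', w))" by (simp add: x_def v'_def)
    have e: "(v, w) \<in> admissible_edges L" and f: "(x', y) \<in> admissible_edges (contract L (v, w))"
      using p by (auto simp: D_def pe)
    note s = swap_edges[OF L e f sw]
    define v2 where "v2 = (if v' = x \<and> y < w then y else v')"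
    define x2 where "x2 = (if x = w then v' else x)"
    have sw2: "swap_edges ((x, y), (v', w)) = ((v2, w), (x2, y))" by (simp add: v2_def x2_def)
    note s2 = swap_edges[OF L s(1,2) sw2]
    \<comment> \<open>Swapping twice restores both upper ends, and each upper end determines its
      edge.\<close>
    have "v2 = v"
      using inj_onD[OF snd_inj_on_admissible_edges[OF L] _ s2(1) e] by simp
    moreover from this have "(x2, y) \<in> admissible_edges (contract L (v, w))"
      using s2(2) by simp
    then have "x2 = x'"
      using inj_onD[OF snd_inj_on_admissible_edges[OF leaf_diagram_contract[OF L e]] _ _ f] by fastforce
    ultimately show ?thesis
      using sw2 s edge_sign_swap[OF L e f sw] unfolding pe sw by (simp add: D_def T_def)
  qed
  have "(\<Sum>p\<in>D. T p) = (\<Sum>p\<in>D. - T p)"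
    by (rule sum.reindex_bij_witness[of _ swap_edges swap_edges]) (use swap in auto)
  then have S: "(\<Sum>p\<in>D. T p) = - (\<Sum>p\<in>D. T p)"
    by (simp add: sum_negf)
  \<comment> \<open>The sum equals its own negative, and a free abelian group has no
    2-torsion.\<close>
  have "(\<Sum>p\<in>D. T p) = 0"
    using S by (rule frag_eq_minus_imp_zero)
  moreover have "(\<Sum>p\<in>D. T p) =
      (\<Sum>e\<in>admissible_edges L. \<Sum>f\<in>admissible_edges (contract L e). T (e, f))"
    unfolding D_def
    by (subst sum.Sigma) (auto intro: finite_admissible_edges L leaf_diagram_contract)
  ultimately show ?thesis
    by (simp add: T_def diagram_coboundary_def frag_cmul_sum)
qed

section \<open>Invariance under homeomorphisms and the cochain complex\<close>

lemma strict_mono_circle_extension: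
  assumes "strict_mono h"
  shows "strict_mono (circle_extension h)"
proof (rule strict_monoI)
  fix x y :: circle assume "x < y"
  then show "circle_extension h x < circle_extension h y"
    using strict_mono_less_eq[OF assms] by (cases x; cases y) (auto simp: less_circle_def)
qed

lemma polygon_less_image:
  assumes "strict_mono H" "finite A" "finite B" "A \<noteq> {}" "B \<noteq> {}"
  shows "polygon_less (H ` A) (H ` B) \<longleftrightarrow> polygon_less A B"
  using assms by (simp add: polygon_less_def strict_mono_less flip: mono_Min_commute[OF strict_mono_mono])

lemma crossing_sign_image:
  assumes "strict_mono H"
  shows "crossing_sign (H ` A) (H ` B) = crossing_sign A B"
  using assms strict_mono_imp_inj_on[OF assms]
  by (simp add: crossing_sign_def prod.reindex inj_on_subset strict_mono_less)

lemma shuffle_sign_image: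
  assumes H: "strict_mono H" and L: "leaf_diagram L"
  shows "shuffle_sign ((`) H ` L) = shuffle_sign L"
proof -
  have "inj ((`) H)"
    using inj_image_eq_iff[OF strict_mono_imp_inj_on[OF H]] by (simp add: inj_on_def)
  then have "inj_on ((`) H) L" by (rule inj_on_subset) simp
  then show ?thesis
    using leaf_diagramD[OF L]
    by (simp add: shuffle_sign_def prod.reindex polygon_less_image[OF H]
        crossing_sign_image[OF H] cong: if_cong)
qed

lemma leaves_image: "leaves ((`) H ` L) = H ` leaves L"
  by auto

lemma position_sign_image:
  assumes "strict_mono H"
  shows "position_sign (H ` S) (H w) = position_sign S w"
  using assms strict_mono_imp_inj_on[OF assms]
  by (simp add: position_sign_def prod.reindex inj_on_subset strict_mono_less_eq)

context
  fixes H :: "circle \<Rightarrow> circle" and L :: "circle set set"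
  assumes H: "strict_mono H" and L: "leaf_diagram L" and HL: "leaf_diagram ((`) H ` L)"
begin

lemma same_colour_image: "same_colour ((`) H ` L) (H a) (H b) \<longleftrightarrow> same_colour L a b"
  using strict_mono_imp_inj_on[OF H] by (auto simp: same_colour_def inj_image_mem_iff)

lemma admissible_edges_image:
  "admissible_edges ((`) H ` L) = map_prod H H ` admissible_edges L"
proof -
  have inj: "inj H" by (rule strict_mono_imp_inj_on[OF H])
  have iff: "(H v, H w) \<in> admissible_edges ((`) H ` L) \<longleftrightarrow> (v, w) \<in> admissible_edges L" for v w
    unfolding admissible_edges_iff[OF L] admissible_edges_iff[OF HL] same_colour_image leaves_image
    by (simp add: inj_image_mem_iff[OF inj] strict_mono_less[OF H])
  show ?thesis
  proof (intro equalityI subsetI)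
    fix e assume e: "e \<in> admissible_edges ((`) H ` L)"
    obtain a b where ab: "e = (a, b)" by (rule prod.exhaust)
    have "a \<in> H ` leaves L" "b \<in> H ` leaves L"
      using e unfolding ab admissible_edges_iff[OF HL] leaves_image by blast+
    then obtain v w where "a = H v" "b = H w" by blast
    with e ab iff show "e \<in> map_prod H H ` admissible_edges L" by force
  next
    fix e assume "e \<in> map_prod H H ` admissible_edges L"
    then show "e \<in> admissible_edges ((`) H ` L)" using iff by auto
  qed
qed

lemma contract_image:
  assumes e: "(v, w) \<in> admissible_edges L"
  shows "contract ((`) H ` L) (H v, H w) = (`) H ` contract L (v, w)"
proof -
  have inj: "inj H" by (rule strict_mono_imp_inj_on[OF H])
  obtain P Q where PQ: "P \<in> L" "Q \<in> L" "v \<in> P" "w \<in> Q"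
    "polygon_of L v = P" "polygon_of L w = Q"
    using admissible_edgeE[OF L e] by metis
  have pol: "polygon_of ((`) H ` L) (H v) = H ` P" "polygon_of ((`) H ` L) (H w) = H ` Q"
    by (rule polygon_of_eq[OF HL]; use PQ in blast)+
  have injL: "inj_on ((`) H) L"
    using inj by (simp add: inj_on_def inj_image_eq_iff)
  have "(`) H ` (L - {P, Q}) = (`) H ` L - {H ` P, H ` Q}"
    using PQ(1,2) by (subst inj_on_image_set_diff[OF injL]) auto
  moreover have "H ` (P \<union> Q - {w}) = H ` P \<union> H ` Q - {H w}"
    by (simp add: image_set_diff[OF inj] image_Un)
  ultimately show ?thesis
    by (simp add: contract_def merged_polygon_def pol PQ(5,6))
qed

text \<open>In the closed formula of \<open>edge_sign_eq\<close> every factor depends only on the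
  order of the leaves and on contraction, both of which \<open>H\<close> respects.\<close>

lemma edge_sign_image:
  assumes e: "(v, w) \<in> admissible_edges L"
  shows "edge_sign ((`) H ` L) (H v, H w) = edge_sign L (v, w)"
proof -
  have He: "(H v, H w) \<in> admissible_edges ((`) H ` L)"
    using e unfolding admissible_edges_image by force
  show ?thesis
    unfolding edge_sign_eq[OF L e] edge_sign_eq[OF HL He] contract_image[OF e] leaves_image
      shuffle_sign_image[OF H L] shuffle_sign_image[OF H leaf_diagram_contract[OF L e]]
      position_sign_image[OF H] by (rule refl)
qed

end

section \<open>From diagrams to their classes\<close>

lemma leaf_class_eqI: "(L, L') \<in> leaf_equiv \<Longrightarrow> leaf_class L = leaf_class L'"
  by (rule equiv_class_eq[OF equiv_leaf_equiv])

lemma diagram_coboundary_cong: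
  assumes "(L, L') \<in> leaf_equiv"
  shows "diagram_coboundary L' = diagram_coboundary L"
proof -
  obtain h g where h: "leaf_diagram L" "leaf_diagram L'" "homeomorphism UNIV UNIV h g"
    "strict_mono h" "L' = (`) (circle_extension h) ` L"
    using assms by (rule leaf_equivE)
  define H where "H = circle_extension h"
  have H: "strict_mono H" unfolding H_def using h(4) by (rule strict_mono_circle_extension)
  have L': "L' = (`) H ` L" using h(5) by (simp add: H_def)
  have HL: "leaf_diagram ((`) H ` L)" using h(2) L' by simp
  have inj: "inj_on (map_prod H H) (admissible_edges L)"
    using prod.inj_map[OF strict_mono_imp_inj_on[OF H] strict_mono_imp_inj_on[OF H]]
    by (rule inj_on_subset) simp
  have summand: "frag_cmul (edge_sign L' (map_prod H H e))
        (frag_of (leaf_class (contract L' (map_prod H H e)))) =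
      frag_cmul (edge_sign L e) (frag_of (leaf_class (contract L e)))" if "e \<in> admissible_edges L" for e
  proof -
    obtain v w where vw: "e = (v, w)" by (rule prod.exhaust)
    have e: "(v, w) \<in> admissible_edges L" using that vw by simp
    have He: "(H v, H w) \<in> admissible_edges ((`) H ` L)"
      using e unfolding admissible_edges_image[OF H h(1) HL] by force
    \<comment> \<open>The homeomorphism relating \<open>L\<close> and \<open>L'\<close> also relates
      their contractions along corresponding edges.\<close>
    have "(contract L (v, w), contract L' (H v, H w)) \<in> leaf_equiv"
    proof (rule leaf_equivI[OF leaf_diagram_contract[OF h(1) e] _ h(3,4)])
      show "leaf_diagram (contract L' (H v, H w))"
        unfolding L' by (rule leaf_diagram_contract[OF HL He])
      show "contract L' (H v, H w) = (`) (circle_extension h) ` contract L (v, w)"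
        unfolding L' H_def[symmetric] by (rule contract_image[OF H h(1) HL e])
    qed
    then have "leaf_class (contract L' (H v, H w)) = leaf_class (contract L (v, w))"
      by (rule leaf_class_eqI[symmetric])
    then show ?thesis
      using edge_sign_image[OF H h(1) HL e] by (simp add: vw L')
  qed
  have "admissible_edges L' = map_prod H H ` admissible_edges L"
    unfolding L' by (rule admissible_edges_image[OF H h(1) HL])
  then show ?thesis
    unfolding diagram_coboundary_def by (simp add: sum.reindex[OF inj] summand)
qed

text \<open>The representative picked by \<open>SOME\<close> is equivalent to \<open>L\<close>, so
  invariance makes the choice harmless.\<close>

lemma diagram_coboundary_some:
  assumes L: "leaf_diagram L"
  shows "diagram_coboundary (SOME L'. L' \<in> leaf_class L) = diagram_coboundary L"
proof -
  have "L \<in> leaf_class L"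
    using equiv_class_self[OF equiv_leaf_equiv] L by simp
  then have "(SOME L'. L' \<in> leaf_class L) \<in> leaf_class L"
    by (rule someI)
  then show ?thesis
    by (intro diagram_coboundary_cong) simp
qed

abbreviation leaf_basis :: "nat \<Rightarrow> int \<Rightarrow> circle set set set set" where
  "leaf_basis d i \<equiv> {L. leaf_diagram L \<and> gauss_degree L = int d \<and> codimension L = i} // leaf_equiv"

lemma leaf_basisE:
  assumes "X \<in> leaf_basis d i"
  obtains L where "leaf_diagram L" "gauss_degree L = int d" "codimension L = i" "X = leaf_class L"
  using assms by (elim quotientE) auto

lemma keys_diagram_coboundary:
  assumes L: "leaf_diagram L" "gauss_degree L = int d" "codimension L = i - 1"
  shows "Poly_Mapping.keys (diagram_coboundary L) \<subseteq> leaf_basis d i"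
proof -
  have "leaf_class (contract L e) \<in> leaf_basis d i" if "e \<in> admissible_edges L" for e
  proof -
    obtain v w where vw: "e = (v, w)" by (rule prod.exhaust)
    have e: "(v, w) \<in> admissible_edges L" using that vw by simp
    show ?thesis
      unfolding vw using leaf_diagram_contract[OF L(1) e] gauss_degree_contract[OF L(1) e]
        codimension_contract[OF L(1) e] L(2,3) by (intro quotientI) simp
  qed
  moreover have "Poly_Mapping.keys (diagram_coboundary L) \<subseteq>
      (\<Union>e\<in>admissible_edges L.
        Poly_Mapping.keys (frag_cmul (edge_sign L e) (frag_of (leaf_class (contract L e)))))"
    unfolding diagram_coboundary_def by (rule keys_sum)
  moreover have "Poly_Mapping.keys (frag_cmul (edge_sign L e) (frag_of (leaf_class (contract L e)))) \<subseteq>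
      {leaf_class (contract L e)}" for e
    using keys_cmul[of "edge_sign L e" "frag_of (leaf_class (contract L e))"] by simp
  ultimately show ?thesis by blast
qed

text \<open>The values on generators, free of \<open>d\<close> and \<open>i\<close>, so that one
  linear extension serves both differentials of a composite.\<close>

definition class_coboundary :: "circle set set set \<Rightarrow> circle set set set \<Rightarrow>\<^sub>0 int" where
  "class_coboundary X = diagram_coboundary (SOME L. L \<in> X)"

lemma class_coboundary_leaf_class:
  "leaf_diagram L \<Longrightarrow> class_coboundary (leaf_class L) = diagram_coboundary L"
  unfolding class_coboundary_def by (rule diagram_coboundary_some)

lemma leaf_coboundary_eq:
  assumes "Poly_Mapping.keys x \<subseteq> leaf_basis d (i - 1)"
  shows "leaf_coboundary d i x = frag_extend class_coboundary x"
  using assms by (simp add: leaf_coboundary_def leaf_module_def class_coboundary_def[abs_def])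

lemma keys_class_coboundary:
  assumes "X \<in> leaf_basis d (i - 1)"
  shows "Poly_Mapping.keys (class_coboundary X) \<subseteq> leaf_basis d i"
  using assms
proof (rule leaf_basisE)
  fix L assume "leaf_diagram L" "gauss_degree L = int d" "codimension L = i - 1" "X = leaf_class L"
  then show ?thesis
    using keys_diagram_coboundary[of L d i] class_coboundary_leaf_class[of L] by simp
qed

lemma keys_extend_class_coboundary:
  assumes "Poly_Mapping.keys x \<subseteq> leaf_basis d (i - 1)"
  shows "Poly_Mapping.keys (frag_extend class_coboundary x) \<subseteq> leaf_basis d i"
  using keys_frag_extend[of class_coboundary x] keys_class_coboundary assms by blast

text \<open>By linearity it suffices to treat a single class, where the claim is
  \<open>coboundary_square_zero\<close> for a representative.\<close>

lemma class_coboundary_square_zero: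
  assumes "Poly_Mapping.keys x \<subseteq> leaf_basis d i"
  shows "frag_extend class_coboundary (frag_extend class_coboundary x) = 0"
  using assms
proof (induction x rule: frag_induction)
  case (one X)
  then obtain L where L: "leaf_diagram L" and X: "X = leaf_class L" by (rule leaf_basisE)
  have "frag_extend class_coboundary (diagram_coboundary L) =
      (\<Sum>e\<in>admissible_edges L. frag_cmul (edge_sign L e) (class_coboundary (leaf_class (contract L e))))"
    unfolding diagram_coboundary_def
    by (simp add: frag_extend_sum[OF finite_admissible_edges[OF L]] frag_extend_cmul)
  also have "\<dots> =
      (\<Sum>e\<in>admissible_edges L. frag_cmul (edge_sign L e) (diagram_coboundary (contract L e)))"
  proof (rule sum.cong[OF refl])
    fix e assume "e \<in> admissible_edges L"
    then have "leaf_diagram (contract L e)"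
      by (cases e) (simp add: leaf_diagram_contract[OF L])
    then show "frag_cmul (edge_sign L e) (class_coboundary (leaf_class (contract L e))) =
        frag_cmul (edge_sign L e) (diagram_coboundary (contract L e))"
      by (simp only: class_coboundary_leaf_class)
  qed
  also have "\<dots> = 0" by (rule coboundary_square_zero[OF L])
  finally show ?case
    by (simp only: X frag_extend_of class_coboundary_leaf_class[OF L])
qed (simp_all add: frag_extend_diff)

text \<open>The second conjunct ties the differential to the formula for every representative
  \<open>L\<close>, and so contains the well-definedness on classes.\<close>

theorem theorem1p3:
  fixes d :: nat
  assumes "d \<ge> 1"
  shows "cochain_complex (leaf_module d) (leaf_coboundary d) \<and>
    (\<forall>i L. leaf_diagram L \<and> gauss_degree L = int d \<and> codimension L = i - 1 \<longrightarrow>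
      leaf_coboundary d i (frag_of (leaf_class L)) =
        (\<Sum>e\<in>admissible_edges L.
          frag_cmul (edge_sign L e) (frag_of (leaf_class (contract L e)))))"
proof (intro conjI allI impI)
  show "cochain_complex (leaf_module d) (leaf_coboundary d)"
    unfolding cochain_complex_def
  proof (intro conjI allI ballI)
    fix i
    show "comm_group (leaf_module d i)"
      unfolding leaf_module_def by (rule abelian_free_Abelian_group)
    have add: "Poly_Mapping.keys (x + y) \<subseteq> leaf_basis d (i - 1)"
      if "Poly_Mapping.keys x \<subseteq> leaf_basis d (i - 1)" "Poly_Mapping.keys y \<subseteq> leaf_basis d (i - 1)"
      for x y :: "circle set set set \<Rightarrow>\<^sub>0 int"
      using keys_add[of x y] that by blast
    show "leaf_coboundary d i \<in> hom (leaf_module d (i - 1)) (leaf_module d i)"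
    proof (rule homI)
      fix x y
      assume x: "x \<in> carrier (leaf_module d (i - 1))"
      then have kx: "Poly_Mapping.keys x \<subseteq> leaf_basis d (i - 1)" by (simp add: leaf_module_def)
      show "leaf_coboundary d i x \<in> carrier (leaf_module d i)"
        using keys_extend_class_coboundary[OF kx]
        by (simp add: leaf_coboundary_eq[OF kx]) (simp add: leaf_module_def)
      assume y: "y \<in> carrier (leaf_module d (i - 1))"
      then have ky: "Poly_Mapping.keys y \<subseteq> leaf_basis d (i - 1)" by (simp add: leaf_module_def)
      show "leaf_coboundary d i (x \<otimes>\<^bsub>leaf_module d (i - 1)\<^esub> y) =
          leaf_coboundary d i x \<otimes>\<^bsub>leaf_module d i\<^esub> leaf_coboundary d i y"
        using leaf_coboundary_eq[OF kx] leaf_coboundary_eq[OF ky] leaf_coboundary_eq[OF add[OF kx ky]]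
        by (simp add: leaf_module_def frag_extend_add)
    qed
    fix x assume "x \<in> carrier (leaf_module d (i - 1))"
    then have kx: "Poly_Mapping.keys x \<subseteq> leaf_basis d (i - 1)" by (simp add: leaf_module_def)
    \<comment> \<open>The outer differential has index \<open>i + 1\<close> and is the linear
      extension only on its source, which appears as degree \<open>i + 1 - 1\<close>.\<close>
    have "Poly_Mapping.keys (frag_extend class_coboundary x) \<subseteq> leaf_basis d (i + 1 - 1)"
      using keys_extend_class_coboundary[OF kx] by simp
    then have "leaf_coboundary d (i + 1) (leaf_coboundary d i x) =
        frag_extend class_coboundary (frag_extend class_coboundary x)"
      unfolding leaf_coboundary_eq[OF kx] by (rule leaf_coboundary_eq)
    then show "leaf_coboundary d (i + 1) (leaf_coboundary d i x) = \<one>\<^bsub>leaf_module d (i + 1)\<^esub>"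
      using class_coboundary_square_zero[OF kx] by (simp add: leaf_module_def)
  qed
next
  fix i L
  assume L: "leaf_diagram L \<and> gauss_degree L = int d \<and> codimension L = i - 1"
  then have "leaf_class L \<in> leaf_basis d (i - 1)" by (intro quotientI) simp
  then have "leaf_coboundary d i (frag_of (leaf_class L)) = diagram_coboundary L"
    using leaf_coboundary_eq[of "frag_of (leaf_class L)" d i] L
    by (simp add: class_coboundary_leaf_class)
  then show "leaf_coboundary d i (frag_of (leaf_class L)) =
      (\<Sum>e\<in>admissible_edges L. frag_cmul (edge_sign L e) (frag_of (leaf_class (contract L e))))"
    by (simp only: diagram_coboundary_def)
qed

end
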